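(* Let $\rho\in B_n$ be a braid whose closure is the oriented link $K\subset S^3$, with mirror $m(K)$. Let $\mathcal H(m(K))$ be the Heegaard diagram for $m(K)$ determined by $\rho$ described in the context, with knot Floer chain complex $\widehat{CF}(\mathcal H(m(K)))$, and consider the state sum expansion of the $U_q(\mathfrak{gl}(1|1))$ invariant of $K$ (with $q=t^{1/2}$) determined by $\rho$, $$\widehat Q(K)=t^{(n-1-\exp(\rho))/2}\sum_{\mathbf j\subset\{2,\dots,n\}}\ \sum_{\sigma\in S_{|\mathbf j|}}\ \sum_{\{y_1,\dots,y_{|\mathbf j|}\}\in\Gamma^{\mathbf j,\mathbf j}_\sigma(\rho)}(-1)^{|\mathbf j|+\mathrm{sgn}(\sigma)}\prod_{r=1}^{|\mathbf j|}\mathrm{sgn}(y_r)\,t^{S(y_r)} .$$ Then there is a bijection $f$ between the generators $x\in\mathbb T_\alpha\cap\mathbb T_\beta$ of $\widehat{CF}(\mathcal H(m(K)))$ and the summands of this expansion, such that for every generator $x$ $$(-1)^{1-n}\,t^{(n-1-\exp(\rho))/2}\,w(x)=w(f(x)),$$ where $w(x)=(-1)^{M(x)}t^{A_1(x)}$ is the weight of a generator with Maslov grading $M(x)$ and Alexander grading $A_1(x)$, and the weight of a summand is its value (including the prefactor $t^{(n-1-\exp(\rho))/2}$). That is, $f$ is weight-preserving up to a global normalization.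
   Context: **Braids, noodles, chopsticks.** $D\subset\mathbb C$ is the closed unit disk, $z_1,\dots,z_n\in D$ are real points with $-1<z_1<\dots<z_n<1$, $\mathbf D_n=D\setminus\{z_1,\dots,z_n\}$, and $B_n$ is the group of isotopy classes of homeomorphisms of $\mathbf D_n$ fixing $\partial D$ pointwise, generated by the clockwise half twists $\sigma_1,\dots,\sigma_{n-1}$ ($\sigma_i$ exchanges $z_i,z_{i+1}$). The braid exponent $\exp(\rho)\in\mathbb Z$ is the number of positive crossings minus the number of negative crossings in any geometric braid diagram of $\rho$; here a positive crossing is a counter-clockwise twist, so the clockwise generators $\sigma_i$ contribute negatively to $\exp(\rho)$. Let $x_0=-i$. The cut arc $\ell_j$ is the vertical segment from $z_j$ up to $\partial D$. The standard noodle $\eta_j$ is the oriented arc from $x_0$ to $x_0$ looping once clockwise around $z_j$ (the frontier of a thin neighborhood of the straight segment from $x_0$ to $z_j$). The standard chopstick $\varepsilon_k$ is the oriented arc from $z_k$ vertically up to $\partial D$, just left of $\ell_k$ and meeting it only in $z_k$. For $y\in\rho(\eta_j)\cap\varepsilon_k$ (transverse), $\mathrm{sgn}(y)\in\{\pm1\}$ is the local intersection sign of $\rho(\eta_j)\cdot\varepsilon_k$. The sheet $S(y)$ is the signed number of times the sub-arc of $\rho(\eta_j)$ from its initial point to $y$ crosses $\ell_1\cup\dots\cup\ell_n$, a left-to-right crossing counting $+1$. For $\mathbf j=\{j_1<\dots<j_m\}$, $\mathbf k=\{k_1<\dots<k_m\}$ and $\sigma\in S_m$, $$\Gamma^{\mathbf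 j,\mathbf k}_\sigma(\rho)=\{\{y_1,\dots,y_m\}\subset\mathbf D_n: y_r\in\rho(\eta_{j_r})\cap\varepsilon_{k_{\sigma(r)}},\ r=1,\dots,m\};$$ $\mathrm{sgn}(\sigma)\in\{0,1\}$ is the parity of $\sigma$. The empty multi-index contributes one summand. **$\widehat Q(K)$** is the scalar by which a $(1,1)$-tangle with closure $K$ acts on the vector representation $V$ of $U_q(\mathfrak{gl}(1|1))$ under the associated Reshetikhin–Turaev functor (conventions of Sartori and Manion). **The diagram $\mathcal H(m(K))$.** Let $w_j=z_j-2i$, view $D\subset\mathbb C\subset S^2$, and extend $\rho$ by the identity to $S^2$. The overbridge $o_j$ is $\rho$ of the vertical segment from $w_j$ to $z_j$. The underbridge $u_j$ starts at $z_j$, goes vertically up to $\mathrm{Im}=1$, right along a semicircle, vertically down to $\mathrm{Im}=-3$, left along a semicircle, then up to $w_j$ (the $u_j$ nested and disjoint). With overbridges over underbridges, this is a diagram of $m(K)$. For $j\in\{2,\dots,n\}$ let $\beta_j$ be the boundary of a regular neighborhood of $o_j$; remove small disks about $z_j$ and $w_j$ and attach a handle along the boundary circles, compatibly with orientations, and let $\alpha_j$ be the closed curve formed by the truncated $u_j$ and an arc through the handle. This gives a genus $n-1$ surface $\Sigma$ with curves $\alpha_2,\dots,\alpha_n$, $\beta_2,\dots,\beta_n$ and basepoints $z_1,w_1$; this is $\mathcal H(m(K))$. Generators of $\widehat{CF}(\mathcal H(m(K)))$, i.e. points of $\mathbb T_\alpha\cap\mathbb T_\beta$ with $\mathbb T_\alpha=\prod\alpha_k$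 and $\mathbb T_\beta=\prod\beta_j$ in the $(n-1)$-fold symmetric product of $\Sigma$, are $(n-1)$-element sets of points of $\alpha\cap\beta$ with exactly one point on each $\alpha_k$ and each $\beta_j$. **Gradings.** Each point of $\beta_j\cap\alpha_k$ is either an anchor point (only if $j=k$: the unique intersection directly below the place where $w_j$ was removed) or lies in $D$ and is identified with a point of $\rho(\eta_j)\cap\varepsilon_k$, since inside $D$ (away from $\partial D$ and the punctures) $\beta_j,\alpha_k$ coincide up to isotopy with $\rho(\eta_j),\varepsilon_k$. The (absolute) Alexander grading of a generator is $A_1(x)=\sum S(x_r)$ over its non-anchor points. Orient $\beta_j$ and $\alpha_k$ extending the orientations of $\rho(\eta_j)$ and $\varepsilon_k$. The absolute Maslov grading is normalized so that $(-1)^{M(x)}=(-1)^{\mathrm{sgn}(\sigma)}\prod_r\mathrm{sgn}(x_r)$, where $x_r\in\beta_{r}\cap\alpha_{\sigma(r)}$ for $r=2,\dots,n$ and signs are those of $\beta\cdot\alpha$ (anchor points have sign $-1$). *)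

theory Defs
  imports
    "HOL-Complex_Analysis.Complex_Analysis"
    "HOL-Combinatorics.Permutations"
    "HOL-Library.Poly_Mapping"
begin

section \<open>Braids as mapping classes of the punctured disk\<close>

text \<open>
  \<open>D\<close> is \<open>cball 0 1\<close>; the punctures are \<open>z 1 < \<dots> < z n\<close>. The values of \<open>z\<close> outside
  \<open>{1..n}\<close> are irrelevant.
\<close>

definition punctures :: "nat \<Rightarrow> (nat \<Rightarrow> real) \<Rightarrow> bool" where
  "punctures n z \<longleftrightarrow> strict_mono_on {1..n} z \<and> z ` {1..n} \<subseteq> {-1<..<1}"

text \<open>
  A homeomorphism of \<open>D\<close> minus the punctures that fixes the boundary of \<open>D\<close> pointwise extends
  uniquely to a homeomorphism of \<open>D\<close> permuting the punctures, and then, by the identity, to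
  \<open>\<complex>\<close>. We work with these extensions.
\<close>

definition braid_homeo :: "nat \<Rightarrow> (nat \<Rightarrow> real) \<Rightarrow> (complex \<Rightarrow> complex) \<Rightarrow> bool" where
  "braid_homeo n z \<rho> \<longleftrightarrow>
     (\<exists>g. homeomorphism UNIV UNIV \<rho> g) \<and>
     (\<forall>x. 1 \<le> cmod x \<longrightarrow> \<rho> x = x) \<and>
     \<rho> ` (\<lambda>i. of_real (z i)) ` {1..n} = (\<lambda>i. of_real (z i)) ` {1..n}"

text \<open>A homotopy through maps satisfying \<^const>\<open>braid_homeo\<close> is an isotopy.\<close>

definition isotopy_class :: "nat \<Rightarrow> (nat \<Rightarrow> real) \<Rightarrow> (complex \<Rightarrow> complex) \<Rightarrow> (complex \<Rightarrow> complex) set" where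
  "isotopy_class n z \<rho> = {\<rho>'. homotopic_with_canon (braid_homeo n z) UNIV UNIV \<rho> \<rho>'}"

definition braid_group :: "nat \<Rightarrow> (nat \<Rightarrow> real) \<Rightarrow> (complex \<Rightarrow> complex) set set" where
  "braid_group n z = isotopy_class n z ` {\<rho>. braid_homeo n z \<rho>}"

text \<open>
  The clockwise half twist exchanging \<open>z i\<close> and \<open>z (i + 1)\<close>: rotation by \<open>- pi\<close> on the disk having
  the segment between them as a diameter, damped to the identity at radius \<open>R\<close>. The disk of radius
  \<open>R\<close> stays in the interior of \<open>D\<close> and contains no other puncture.
\<close>

definition half_twist :: "nat \<Rightarrow> (nat \<Rightarrow> real) \<Rightarrow> nat \<Rightarrow> complex \<Rightarrow> complex" where
  "half_twist n z i x =
     (let c = of_real ((z i + z (i + 1)) / 2);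
          d = (z (i + 1) - z i) / 2;
          left_gap = z i - (if i = 1 then - 1 else z (i - 1));
          right_gap = (if i + 1 = n then 1 else z (i + 2)) - z (i + 1);
          R = d + min left_gap right_gap / 2
      in c + (x - c) * cis (- pi * max 0 (min 1 ((R - cmod (x - c)) / (R - d)))))"

text \<open>Letters \<open>(i, True)\<close> and \<open>(i, False)\<close> stand for \<open>\<sigma>\<^sub>i\<close> and its inverse.\<close>

fun braid_word :: "nat \<Rightarrow> (nat \<Rightarrow> real) \<Rightarrow> (nat \<times> bool) list \<Rightarrow> complex \<Rightarrow> complex" where
  "braid_word n z [] = id"
| "braid_word n z ((i, True) # w) = half_twist n z i \<circ> braid_word n z w"
| "braid_word n z ((i, False) # w) = inv (half_twist n z i) \<circ> braid_word n z w"

text \<open>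
  A braid diagram is a word in the generators; a positive crossing is a counter-clockwise twist,
  so the letter \<open>\<sigma>\<^sub>i\<close> counts \<open>-1\<close>. The value does not depend on the word, since the braid relations
  preserve the exponent sum.
\<close>

definition braid_exponent :: "nat \<Rightarrow> (nat \<Rightarrow> real) \<Rightarrow> (complex \<Rightarrow> complex) set \<Rightarrow> int" where
  "braid_exponent n z b =
     (THE e. \<exists>w. fst ` set w \<subseteq> {1..<n} \<and> braid_word n z w \<in> b \<and>
                 e = (\<Sum>(i, s)\<leftarrow>w. if s then - 1 else 1))"


section \<open>Crossings of a path with an oriented segment\<close>

text \<open>
  \<open>Im ((x - a) / (b - a))\<close> is positive on the left and negative on the right of the line directed
  from \<open>a\<close> to \<open>b\<close>. A path crossing from left to right, followed by the direction of the segment,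
  is a positive frame of \<open>\<complex>\<close>; such a crossing has sign \<open>+1\<close>.
\<close>

definition crossing_sign :: "(real \<Rightarrow> complex) \<Rightarrow> complex \<Rightarrow> complex \<Rightarrow> real \<Rightarrow> int" where
  "crossing_sign \<gamma> a b t =
     (let side = (\<lambda>s. Im ((\<gamma> s - a) / (b - a))) in
      if (\<forall>\<^sub>F s in at_left t. side s > 0) \<and> (\<forall>\<^sub>F s in at_right t. side s < 0) then 1
      else if (\<forall>\<^sub>F s in at_left t. side s < 0) \<and> (\<forall>\<^sub>F s in at_right t. side s > 0) then - 1
      else 0)"

definition transverse :: "(real \<Rightarrow> complex) \<Rightarrow> complex \<Rightarrow> complex \<Rightarrow> bool" where
  "transverse \<gamma> a b \<longleftrightarrow>
     (\<forall>t\<in>{0..1}. \<gamma> t \<in> closed_segment a b \<longrightarrow>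
        0 < t \<and> t < 1 \<and> \<gamma> t \<in> open_segment a b \<and> crossing_sign \<gamma> a b t \<noteq> 0)"

text \<open>For paths passing exactly once through \<open>y\<close>, at an interior time.\<close>

definition passing_time :: "(real \<Rightarrow> complex) \<Rightarrow> complex \<Rightarrow> real" where
  "passing_time \<gamma> y = (THE t. 0 < t \<and> t < 1 \<and> \<gamma> t = y)"

text \<open>The local sign of \<open>\<gamma> \<cdot> L\<close> at \<open>y\<close>, for \<open>L\<close> the vertical line over the real point \<open>a\<close>, directed upwards.\<close>

definition vertical_sign :: "(real \<Rightarrow> complex) \<Rightarrow> real \<Rightarrow> complex \<Rightarrow> int" where
  "vertical_sign \<gamma> a y = crossing_sign \<gamma> (of_real a) (of_real a + \<i>) (passing_time \<gamma> y)"


section \<open>Noodles, chopsticks and cut arcs\<close>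

definition noodle_base :: complex where
  "noodle_base = - \<i>"

text \<open>
  The thin neighborhood of the segment from \<open>-\<i>\<close> to \<open>z j\<close> is a kite with vertex \<open>-\<i>\<close>. With \<open>u\<close>
  the direction of the segment, its other vertices lie to the left of \<open>z j\<close>, beyond it, and to the
  right of it; the noodle runs through them in this order, that is, clockwise around \<open>z j\<close>.
\<close>

definition noodle_corner :: "(nat \<Rightarrow> real) \<Rightarrow> real \<Rightarrow> nat \<Rightarrow> complex \<Rightarrow> complex" where
  "noodle_corner z \<delta> j v = of_real (z j) + of_real \<delta> * v * sgn (of_real (z j) - noodle_base)"

definition noodle :: "(nat \<Rightarrow> real) \<Rightarrow> real \<Rightarrow> nat \<Rightarrow> real \<Rightarrow> complex" where
  "noodle z \<delta> j =
     linepath noodle_base (noodle_corner z \<delta> j \<i>) +++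
     linepath (noodle_corner z \<delta> j \<i>) (noodle_corner z \<delta> j 1) +++
     linepath (noodle_corner z \<delta> j 1) (noodle_corner z \<delta> j (- \<i>)) +++
     linepath (noodle_corner z \<delta> j (- \<i>)) noodle_base"

definition noodle_disk :: "(nat \<Rightarrow> real) \<Rightarrow> real \<Rightarrow> nat \<Rightarrow> complex set" where
  "noodle_disk z \<delta> j =
     convex hull {noodle_base, noodle_corner z \<delta> j \<i>, noodle_corner z \<delta> j 1, noodle_corner z \<delta> j (- \<i>)}"

definition thin_noodles :: "nat \<Rightarrow> (nat \<Rightarrow> real) \<Rightarrow> real \<Rightarrow> bool" where
  "thin_noodles n z \<delta> \<longleftrightarrow>
     0 < \<delta> \<and>
     (\<forall>j\<in>{1..n}. \<forall>v\<in>{\<i>, 1, - \<i>}. cmod (noodle_corner z \<delta> j v) < 1) \<and>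
     (\<forall>i\<in>{1..n}. \<forall>j\<in>{1..n}. i \<noteq> j \<longrightarrow> noodle_disk z \<delta> i \<inter> noodle_disk z \<delta> j = {noodle_base})"

definition noodle_image :: "(nat \<Rightarrow> real) \<Rightarrow> real \<Rightarrow> (complex \<Rightarrow> complex) \<Rightarrow> nat \<Rightarrow> real \<Rightarrow> complex" where
  "noodle_image z \<delta> \<rho> j = \<rho> \<circ> noodle z \<delta> j"

text \<open>
  The point of the boundary circle above the real point \<open>x\<close>. The chopstick is exactly vertical.
  The cut arc, which has to meet it only in the puncture and to lie just to its right, is tilted
  to the right by \<open>\<kappa>\<close>, measured at its upper end.
\<close>

definition upper_point :: "real \<Rightarrow> complex" where
  "upper_point x = Complex x (sqrt (1 - x\<^sup>2))"

definition chopstick :: "(nat \<Rightarrow> real) \<Rightarrow> nat \<Rightarrow> complex set" where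
  "chopstick z k = closed_segment (of_real (z k)) (upper_point (z k))"

definition cut :: "(nat \<Rightarrow> real) \<Rightarrow> real \<Rightarrow> nat \<Rightarrow> complex set" where
  "cut z \<kappa> i = closed_segment (of_real (z i)) (upper_point (z i + \<kappa>))"

definition narrow_cuts :: "nat \<Rightarrow> (nat \<Rightarrow> real) \<Rightarrow> real \<Rightarrow> bool" where
  "narrow_cuts n z \<kappa> \<longleftrightarrow>
     0 < \<kappa> \<and> (\<forall>i\<in>{1..n}. z i + \<kappa> < (if i = n then 1 else z (i + 1)))"

definition transverse_noodles :: "nat \<Rightarrow> (nat \<Rightarrow> real) \<Rightarrow> real \<Rightarrow> (nat \<Rightarrow> real \<Rightarrow> complex) \<Rightarrow> bool" where
  "transverse_noodles n z \<kappa> \<gamma> \<longleftrightarrow>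
     (\<forall>j\<in>{2..n}.
        (\<forall>k\<in>{2..n}. transverse (\<gamma> j) (of_real (z k)) (upper_point (z k))) \<and>
        (\<forall>i\<in>{1..n}. transverse (\<gamma> j) (of_real (z i)) (upper_point (z i + \<kappa>))))"


section \<open>The state sum\<close>

text \<open>In this section \<open>\<gamma> j\<close> is the image of the \<open>j\<close>-th standard noodle under the braid.\<close>

definition sheet :: "nat \<Rightarrow> (nat \<Rightarrow> real) \<Rightarrow> real \<Rightarrow> (nat \<Rightarrow> real \<Rightarrow> complex) \<Rightarrow> nat \<Rightarrow> complex \<Rightarrow> int" where
  "sheet n z \<kappa> \<gamma> j y =
     (\<Sum>i\<in>{1..n}. \<Sum>t | 0 < t \<and> t < passing_time (\<gamma> j) y \<and> \<gamma> j t \<in> cut z \<kappa> i.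
        crossing_sign (\<gamma> j) (of_real (z i)) (upper_point (z i + \<kappa>)) t)"

text \<open>
  Multi-indices are finite sets, enumerated increasingly. Positions and permutations are counted
  from \<open>0\<close>.
\<close>

definition entry :: "nat set \<Rightarrow> nat \<Rightarrow> nat" where
  "entry J r = sorted_list_of_set J ! r"

definition Gamma_set ::
  "(nat \<Rightarrow> real) \<Rightarrow> (nat \<Rightarrow> real \<Rightarrow> complex) \<Rightarrow> nat set \<Rightarrow> nat set \<Rightarrow> (nat \<Rightarrow> nat) \<Rightarrow> complex set set" where
  "Gamma_set z \<gamma> J K \<sigma> =
     {y ` {..<card J} | y. \<forall>r<card J. y r \<in> path_image (\<gamma> (entry J r)) \<inter> chopstick z (entry K (\<sigma> r))}"

definition summands ::
  "nat \<Rightarrow> (nat \<Rightarrow> real) \<Rightarrow> (nat \<Rightarrow> real \<Rightarrow> complex) \<Rightarrow> (nat set \<times> (nat \<Rightarrow> nat) \<times> complex set) set" where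
  "summands n z \<gamma> =
     {(J, \<sigma>, Y). J \<subseteq> {2..n} \<and> \<sigma> permutes {..<card J} \<and> Y \<in> Gamma_set z \<gamma> J J \<sigma>}"

text \<open>
  Laurent polynomials in \<open>t\<^sup>1\<^sup>/\<^sup>2\<close> are elements of the group ring \<open>\<rat> \<Rightarrow>\<^sub>0 \<rat>\<close> (exponents to
  coefficients); \<open>monomial a c\<close> is \<open>c t\<^sup>a\<close>.
\<close>

abbreviation monomial :: "rat \<Rightarrow> rat \<Rightarrow> (rat \<Rightarrow>\<^sub>0 rat)" where
  "monomial \<equiv> Poly_Mapping.single"

definition prefactor :: "nat \<Rightarrow> int \<Rightarrow> (rat \<Rightarrow>\<^sub>0 rat)" where
  "prefactor n e = monomial ((of_nat n - 1 - of_int e) / 2) 1"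

definition summand_point :: "(nat \<Rightarrow> real \<Rightarrow> complex) \<Rightarrow> complex set \<Rightarrow> nat \<Rightarrow> complex" where
  "summand_point \<gamma> Y j = (THE y. y \<in> Y \<inter> path_image (\<gamma> j))"

definition summand_weight ::
  "nat \<Rightarrow> (nat \<Rightarrow> real) \<Rightarrow> real \<Rightarrow> (nat \<Rightarrow> real \<Rightarrow> complex) \<Rightarrow> int \<Rightarrow>
   nat set \<times> (nat \<Rightarrow> nat) \<times> complex set \<Rightarrow> (rat \<Rightarrow>\<^sub>0 rat)" where
  "summand_weight n z \<kappa> \<gamma> e = (\<lambda>(J, \<sigma>, Y).
     prefactor n e * ((- 1) ^ card J * of_int (sign \<sigma>) *
       (\<Prod>r<card J.
          of_int (vertical_sign (\<gamma> (entry J r)) (z (entry J (\<sigma> r))) (summand_point \<gamma> Y (entry J r))) *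
          monomial (of_int (sheet n z \<kappa> \<gamma> (entry J r) (summand_point \<gamma> Y (entry J r)))) 1)))"


section \<open>The Heegaard diagram\<close>

definition w_point :: "(nat \<Rightarrow> real) \<Rightarrow> nat \<Rightarrow> complex" where
  "w_point z j = of_real (z j) - 2 * \<i>"

text \<open>
  The upper semicircles are concentric about \<open>2 + \<i>\<close>, the lower ones about \<open>2 - 3\<i>\<close>, which makes
  different underbridges nested and disjoint.
\<close>

definition underbridge :: "(nat \<Rightarrow> real) \<Rightarrow> nat \<Rightarrow> real \<Rightarrow> complex" where
  "underbridge z j =
     linepath (of_real (z j)) (of_real (z j) + \<i>) +++
     part_circlepath (2 + \<i>) (2 - z j) pi 0 +++
     linepath (of_real (4 - z j) + \<i>) (of_real (4 - z j) - 3 * \<i>) +++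
     part_circlepath (2 - 3 * \<i>) (2 - z j) 0 (- pi) +++
     linepath (of_real (z j) - 3 * \<i>) (w_point z j)"

text \<open>
  The boundary of a regular neighborhood of the overbridge \<open>\<rho> ` closed_segment (w_point z j) (z j)\<close>:
  the image under \<open>\<rho>\<close> of the boundary of the rectangle at distance \<open>d\<close> from the segment. It is
  traversed clockwise, starting at the lower left corner, which is the direction of the noodles.
\<close>

definition beta_curve :: "(nat \<Rightarrow> real) \<Rightarrow> real \<Rightarrow> (complex \<Rightarrow> complex) \<Rightarrow> nat \<Rightarrow> real \<Rightarrow> complex" where
  "beta_curve z d \<rho> j =
     \<rho> \<circ> reversepath (rectpath (w_point z j - Complex d d) (of_real (z j) + Complex d d))"

text \<open>\<open>h\<close> is the radius of the disks around \<open>z j\<close> and \<open>w j\<close> that are replaced by a handle.\<close>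

definition thin_bridges ::
  "nat \<Rightarrow> (nat \<Rightarrow> real) \<Rightarrow> real \<Rightarrow> real \<Rightarrow> (nat \<Rightarrow> real \<Rightarrow> complex) \<Rightarrow> bool" where
  "thin_bridges n z d h \<beta> \<longleftrightarrow>
     0 < h \<and> h < d \<and>
     (\<forall>j\<in>{1..n}. cmod (Complex (\<bar>z j\<bar> + d) d) < 1) \<and>
     (\<forall>i\<in>{1..n}. \<forall>j\<in>{1..n}. i \<noteq> j \<longrightarrow> 2 * d < \<bar>z i - z j\<bar>) \<and>
     (\<forall>i\<in>{2..n}. \<forall>j\<in>{2..n}.
        path_image (\<beta> j) \<inter> (cball (of_real (z i)) h \<union> cball (w_point z i) h) = {})"

text \<open>
  The curves \<open>\<gamma>\<close> (a noodle image) and \<open>\<beta>\<close> coincide as oriented curves, except for end portions of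
  both lying in the open lower half-plane; there \<open>\<gamma>\<close> runs to its end points at \<open>-\<i>\<close>, while \<open>\<beta>\<close>
  leaves the disk and closes up around the lower end of the bridge.
\<close>

definition coincide :: "(real \<Rightarrow> complex) \<Rightarrow> (real \<Rightarrow> complex) \<Rightarrow> bool" where
  "coincide \<gamma> \<beta> \<longleftrightarrow>
     (\<exists>a b a' b' \<phi>.
        0 < a \<and> a < b \<and> b < 1 \<and> 0 < a' \<and> a' < b' \<and> b' < 1 \<and>
        continuous_on {a..b} \<phi> \<and> strict_mono_on {a..b} \<phi> \<and> \<phi> a = a' \<and> \<phi> b = b' \<and>
        (\<forall>t\<in>{a..b}. \<beta> t = \<gamma> (\<phi> t)) \<and>
        (\<forall>t\<in>{0..1} - {a..b}. Im (\<beta> t) < 0) \<and>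
        (\<forall>s\<in>{0..1} - {a'..b'}. Im (\<gamma> s) < 0))"

text \<open>
  Points of the Heegaard surface: the sphere is the one-point compactification of \<open>\<complex>\<close> (with
  \<open>None\<close> at infinity), and \<open>Handle j u s\<close> with \<open>cmod u = 1\<close> and \<open>0 < s < 1\<close> is a point of the
  \<open>j\<close>-th handle.
\<close>

datatype surface_point = Sphere "complex option" | Handle nat complex real

definition sphere_part :: "nat \<Rightarrow> (nat \<Rightarrow> real) \<Rightarrow> real \<Rightarrow> complex option set" where
  "sphere_part n z h = UNIV - Some ` (\<Union>j\<in>{2..n}. ball (of_real (z j)) h \<union> ball (w_point z j) h)"

text \<open>
  The complex conjugation at the lower end makes the gluing compatible with the orientations of
  the sphere and of the cylinder.
\<close>

definition glue :: "(nat \<Rightarrow> real) \<Rightarrow> real \<Rightarrow> nat \<Rightarrow> complex \<times> real \<Rightarrow> surface_point" where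
  "glue z h j = (\<lambda>(u, s).
     if s = 0 then Sphere (Some (of_real (z j) + of_real h * u))
     else if s = 1 then Sphere (Some (w_point z j + of_real h * cnj u))
     else Handle j u s)"

definition surface_carrier :: "nat \<Rightarrow> (nat \<Rightarrow> real) \<Rightarrow> real \<Rightarrow> surface_point set" where
  "surface_carrier n z h =
     Sphere ` sphere_part n z h \<union> (\<Union>j\<in>{2..n}. glue z h j ` (sphere 0 1 \<times> {0..1}))"

text \<open>The quotient topology of the disjoint union of \<open>sphere_part\<close> and the closed cylinders.\<close>

definition surface_open :: "nat \<Rightarrow> (nat \<Rightarrow> real) \<Rightarrow> real \<Rightarrow> surface_point set \<Rightarrow> bool" where
  "surface_open n z h U \<longleftrightarrow>
     U \<subseteq> surface_carrier n z h \<and>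
     openin (subtopology (Alexandroff_compactification euclidean) (sphere_part n z h))
       {p \<in> sphere_part n z h. Sphere p \<in> U} \<and>
     (\<forall>j\<in>{2..n}. openin (top_of_set (sphere 0 1 \<times> {0..1}))
       {c \<in> sphere 0 1 \<times> {0..1}. glue z h j c \<in> U})"

lemma istopology_surface_open: "istopology (surface_open n z h)"
proof -
  have inter: "{x \<in> A. f x \<in> S \<inter> T} = {x \<in> A. f x \<in> S} \<inter> {x \<in> A. f x \<in> T}"
    for A :: "'x set" and f :: "'x \<Rightarrow> surface_point" and S T
    by auto
  have union: "{x \<in> A. f x \<in> \<Union>\<K>} = (\<Union>S\<in>\<K>. {x \<in> A. f x \<in> S})"
    for A :: "'x set" and f :: "'x \<Rightarrow> surface_point" and \<K>
    by auto
  show ?thesis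
    unfolding istopology_def surface_open_def inter union
    by (intro conjI allI impI ballI openin_Int openin_Union) auto
qed

record heegaard =
  surface :: "surface_point topology"
  indices :: "nat set"
  alpha :: "nat \<Rightarrow> surface_point set"
  beta :: "nat \<Rightarrow> surface_point set"
  base_z :: surface_point
  base_w :: surface_point

text \<open>
  The truncated underbridge leaves the upper disk at \<open>z j + h \<i>\<close> and reaches the lower one at
  \<open>w j - h \<i>\<close>; both are glued to the ends of the arc \<open>u = \<i>\<close> of the handle.
\<close>

definition heegaard_diagram ::
  "nat \<Rightarrow> (nat \<Rightarrow> real) \<Rightarrow> real \<Rightarrow> (nat \<Rightarrow> real \<Rightarrow> complex) \<Rightarrow> heegaard" where
  "heegaard_diagram n z h \<beta> =
     \<lparr> surface = topology (surface_open n z h),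
       indices = {2..n},
       alpha = (\<lambda>k.
         Sphere ` Some ` (path_image (underbridge z k) - (ball (of_real (z k)) h \<union> ball (w_point z k) h)) \<union>
         Handle k \<i> ` {0<..<1}),
       beta = (\<lambda>j. Sphere ` Some ` path_image (\<beta> j)),
       base_z = Sphere (Some (of_real (z 1))),
       base_w = Sphere (Some (w_point z 1)) \<rparr>"

text \<open>The generators of the complex, i.e. the points of \<open>T\<^sub>\<alpha> \<inter> T\<^sub>\<beta>\<close> in the symmetric product.\<close>

definition generators :: "heegaard \<Rightarrow> surface_point set set" where
  "generators H =
     {X. finite X \<and> card X = card (indices H) \<and>
         X \<subseteq> (\<Union>k\<in>indices H. alpha H k) \<inter> (\<Union>j\<in>indices H. beta H j) \<and>
         (\<forall>k\<in>indices H. \<exists>!x. x \<in> X \<inter> alpha H k) \<and>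
         (\<forall>j\<in>indices H. \<exists>!x. x \<in> X \<inter> beta H j)}"


section \<open>Gradings of the generators\<close>

text \<open>
  For a generator \<open>X\<close>, \<open>generator_point \<beta> X r\<close> is the point \<open>x\<^sub>r\<close> of \<open>X\<close> on the \<open>r\<close>-th \<open>\<beta>\<close>-curve, as
  a point of \<open>\<complex>\<close>: the \<open>\<beta>\<close>-curves do not enter the handles.
\<close>

definition generator_point :: "(nat \<Rightarrow> real \<Rightarrow> complex) \<Rightarrow> surface_point set \<Rightarrow> nat \<Rightarrow> complex" where
  "generator_point \<beta> X r = (THE y. Sphere (Some y) \<in> X \<and> y \<in> path_image (\<beta> r))"

definition generator_perm :: "heegaard \<Rightarrow> surface_point set \<Rightarrow> nat \<Rightarrow> nat" where
  "generator_perm H X =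
     (THE \<sigma>. \<sigma> permutes indices H \<and>
             (\<forall>r\<in>indices H. \<exists>x\<in>X. x \<in> beta H r \<inter> alpha H (\<sigma> r)))"

definition anchor :: "(nat \<Rightarrow> real) \<Rightarrow> real \<Rightarrow> nat \<Rightarrow> complex" where
  "anchor z d j = w_point z j - of_real d * \<i>"

text \<open>
  A non-anchor point lies in the part of the \<open>r\<close>-th \<open>\<beta>\<close>-curve shared with the noodle image \<open>\<gamma> r\<close>, and
  its sheet is taken along the latter.
\<close>

definition alexander ::
  "nat \<Rightarrow> (nat \<Rightarrow> real) \<Rightarrow> real \<Rightarrow> real \<Rightarrow> (nat \<Rightarrow> real \<Rightarrow> complex) \<Rightarrow> (nat \<Rightarrow> real \<Rightarrow> complex) \<Rightarrow>
   surface_point set \<Rightarrow> int" where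
  "alexander n z \<kappa> d \<gamma> \<beta> X =
     (\<Sum>r | r \<in> {2..n} \<and> generator_point \<beta> X r \<noteq> anchor z d r.
        sheet n z \<kappa> \<gamma> r (generator_point \<beta> X r))"

text \<open>
  The intersection signs are those of \<open>\<beta> \<cdot> \<alpha>\<close>. All intersections lie on the first leg of an
  underbridge (non-anchor points) or on its last leg (anchor points). Both legs lie on the vertical
  line through the puncture and are directed upwards, so \<open>vertical_sign\<close> applies. In particular
  anchor points have sign \<open>-1\<close>, the lower side of the rectangle being traversed from right to left.
\<close>

definition maslov_sign ::
  "nat \<Rightarrow> (nat \<Rightarrow> real) \<Rightarrow> real \<Rightarrow> (nat \<Rightarrow> real \<Rightarrow> complex) \<Rightarrow> surface_point set \<Rightarrow> int" where
  "maslov_sign n z h \<beta> X =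
     (let \<sigma> = generator_perm (heegaard_diagram n z h \<beta>) X in
      sign \<sigma> * (\<Prod>r\<in>{2..n}. vertical_sign (\<beta> r) (z (\<sigma> r)) (generator_point \<beta> X r)))"

definition generator_weight :: "int \<Rightarrow> int \<Rightarrow> (rat \<Rightarrow>\<^sub>0 rat)" where
  "generator_weight m a = monomial (of_int a) ((- 1) powi m)"

end

theory Submission
  imports Defs
begin

text \<open>
  The two sets are compared point by point. The curve \<open>\<alpha>\<^sub>k\<close> meets \<open>\<beta>\<^sub>j\<close> in the points of the
  chopstick \<open>\<epsilon>\<^sub>k\<close> on the image of the noodle \<open>\<eta>\<^sub>j\<close> and, if \<open>j = k\<close>, in one further point, the anchor
  below \<open>w\<^sub>j\<close> (\<open>in_alpha_iff\<close>, \<open>gamma_iff_beta\<close>). A generator is therefore the same as the set \<open>J\<close> of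
  those indices \<open>j\<close> for which the point on \<open>\<beta>\<^sub>j\<close> is not the anchor, a permutation of \<open>J\<close>, and a
  choice of intersection points of noodle images and chopsticks according to this permutation. The
  permutation preserves \<open>J\<close> because an anchor on \<open>\<beta>\<^sub>j\<close> occupies \<open>\<alpha>\<^sub>j\<close>. These are the data of a
  summand, and conversely a summand becomes a generator by adding the anchors for the indices
  outside \<open>J\<close> (\<open>bij_betw_generator_of\<close>). The bijection of the theorem is the inverse of this map.

  For the weights (\<open>generator_of_weight\<close>), the permutation of a generator extends that of the summand
  by fixed points, so the two have the same sign. At a point on a chopstick the \<open>\<beta>\<close>-curve is an
  increasing reparametrization of the noodle image, so the local signs agree
  (\<open>vertical_sign_chopstick\<close>), and the sheets are the same by definition. Every anchor contributes
  the sign \<open>-1\<close> (\<open>vertical_sign_anchor\<close>) and nothing to the Alexander grading, and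
  \<open>(-1)\<^bsup>1-n\<^esup> (-1)\<^bsup>n-1-|J|\<^esup> = (-1)\<^bsup>|J|\<^esup>\<close>.
\<close>

section \<open>Crossing signs under reparametrization\<close>

lemma strict_mono_on_inv_into:
  fixes \<phi> :: "real \<Rightarrow> real"
  assumes "continuous_on {a..b} \<phi>" "strict_mono_on {a..b} \<phi>" "a < b"
  shows "\<phi> ` {a..b} = {\<phi> a..\<phi> b}"
    and "continuous_on {\<phi> a..\<phi> b} (inv_into {a..b} \<phi>)"
    and "strict_mono_on {\<phi> a..\<phi> b} (inv_into {a..b} \<phi>)"
proof -
  have inj: "inj_on \<phi> {a..b}"
    using assms(2) by (rule strict_mono_on_imp_inj_on)
  have le: "\<phi> x \<le> \<phi> y" if "x \<in> {a..b}" "y \<in> {a..b}" "x \<le> y" for x y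
    using that assms(2) by (auto simp: strict_mono_on_def le_less)
  show img: "\<phi> ` {a..b} = {\<phi> a..\<phi> b}"
  proof
    show "\<phi> ` {a..b} \<subseteq> {\<phi> a..\<phi> b}"
      using le assms(3) by auto
    show "{\<phi> a..\<phi> b} \<subseteq> \<phi> ` {a..b}"
      using IVT'[of \<phi> a _ b] assms by (auto simp: image_iff) (metis atLeastAtMost_iff less_imp_le)
  qed
  have "continuous_on (\<phi> ` {a..b}) (inv_into {a..b} \<phi>)"
    using assms(1) inj by (intro continuous_on_inv) auto
  then show "continuous_on {\<phi> a..\<phi> b} (inv_into {a..b} \<phi>)"
    by (simp add: img)
  show "strict_mono_on {\<phi> a..\<phi> b} (inv_into {a..b} \<phi>)"
  proof (rule strict_mono_onI)
    fix u v assume uv: "u \<in> {\<phi> a..\<phi> b}" "v \<in> {\<phi> a..\<phi> b}" "u < v"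
    then have "u \<in> \<phi> ` {a..b}" "v \<in> \<phi> ` {a..b}"
      by (simp_all add: img)
    note in_ab = this[THEN inv_into_into] and eq = this[THEN f_inv_into_f]
    show "inv_into {a..b} \<phi> u < inv_into {a..b} \<phi> v"
      using le[OF in_ab(2,1)] eq uv(3) by linarith
  qed
qed

lemma filterlim_strict_mono_on_sides:
  fixes \<phi> :: "real \<Rightarrow> real"
  assumes "continuous_on {a..b} \<phi>" "strict_mono_on {a..b} \<phi>" "t \<in> {a<..<b}"
  shows "filterlim \<phi> (at_left (\<phi> t)) (at_left t)"
    and "filterlim \<phi> (at_right (\<phi> t)) (at_right t)"
proof -
  have "isCont \<phi> t"
    using assms by (intro continuous_on_interior[of "{a..b}"]) (auto simp: interior_atLeastAtMost_real)
  then have lim: "(\<phi> \<longlongrightarrow> \<phi> t) (at_left t)" "(\<phi> \<longlongrightarrow> \<phi> t) (at_right t)"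
    by (auto simp: isCont_def filterlim_at_split)
  have "\<forall>\<^sub>F s in at_left t. s \<in> {a<..<t}" "\<forall>\<^sub>F s in at_right t. s \<in> {t<..<b}"
    using assms(3) by (auto intro: eventually_at_leftI eventually_at_rightI)
  then have "\<forall>\<^sub>F s in at_left t. \<phi> s < \<phi> t" "\<forall>\<^sub>F s in at_right t. \<phi> t < \<phi> s"
    using assms(2,3) by (auto elim!: eventually_mono simp: strict_mono_on_def)
  then show "filterlim \<phi> (at_left (\<phi> t)) (at_left t)" "filterlim \<phi> (at_right (\<phi> t)) (at_right t)"
    using lim by (auto simp: filterlim_at elim!: eventually_mono)
qed

text \<open>
  The crossing sign only sees the germs of the curve on the two sides of the crossing time, and an
  increasing homeomorphism of parameter intervals carries left germs to left germs and right germs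
  to right germs. Both \<open>\<phi>\<close> and its inverse are needed, since the sign also records that a germ
  does not lie on a given side.
\<close>

lemma crossing_sign_reparametrize:
  assumes cont: "continuous_on {a..b} \<phi>" and mono: "strict_mono_on {a..b} \<phi>"
    and t: "t \<in> {a<..<b}" and eq: "\<And>s. s \<in> {a..b} \<Longrightarrow> \<beta> s = \<gamma> (\<phi> s)"
  shows "crossing_sign \<beta> p q t = crossing_sign \<gamma> p q (\<phi> t)"
proof -
  define \<psi> where "\<psi> = inv_into {a..b} \<phi>"
  have ab: "a < b"
    using t by simp
  note inv = strict_mono_on_inv_into[OF cont mono ab, folded \<psi>_def]
  have inj: "inj_on \<phi> {a..b}"
    using mono by (rule strict_mono_on_imp_inj_on)
  have \<psi>t: "\<psi> (\<phi> t) = t"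
    using t inj by (simp add: \<psi>_def)
  have \<phi>t: "\<phi> t \<in> {\<phi> a<..<\<phi> b}"
    using mono t by (auto simp: strict_mono_on_def)
  have eq': "\<gamma> s = \<beta> (\<psi> s)" if "s \<in> {\<phi> a..\<phi> b}" for s
    using that eq[of "\<psi> s"] inv_into_into[of s \<phi> "{a..b}"] f_inv_into_f[of s \<phi> "{a..b}"]
    unfolding inv(1)[symmetric] \<psi>_def by simp
  note lim = filterlim_strict_mono_on_sides[OF cont mono t]
  note lim' = filterlim_strict_mono_on_sides[OF inv(2,3) \<phi>t, unfolded \<psi>t]
  have near: "\<forall>\<^sub>F s in at_left t. s \<in> {a..b}" "\<forall>\<^sub>F s in at_right t. s \<in> {a..b}"
    using eventually_at_leftI[of a t "\<lambda>s. s \<in> {a..b}"] eventually_at_rightI[of t b "\<lambda>s. s \<in> {a..b}"] t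
    by auto
  have near': "\<forall>\<^sub>F s in at_left (\<phi> t). s \<in> {\<phi> a..\<phi> b}" "\<forall>\<^sub>F s in at_right (\<phi> t). s \<in> {\<phi> a..\<phi> b}"
    using eventually_at_leftI[of "\<phi> a" "\<phi> t" "\<lambda>s. s \<in> {\<phi> a..\<phi> b}"]
      eventually_at_rightI[of "\<phi> t" "\<phi> b" "\<lambda>s. s \<in> {\<phi> a..\<phi> b}"] \<phi>t
    by auto
  have left: "(\<forall>\<^sub>F s in at_left t. P (\<beta> s)) \<longleftrightarrow> (\<forall>\<^sub>F s in at_left (\<phi> t). P (\<gamma> s))" for P
  proof
    assume "\<forall>\<^sub>F s in at_left t. P (\<beta> s)"
    then have "\<forall>\<^sub>F s in at_left (\<phi> t). P (\<beta> (\<psi> s))"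
      using lim'(1) by (rule eventually_compose_filterlim)
    with near'(1) show "\<forall>\<^sub>F s in at_left (\<phi> t). P (\<gamma> s)"
      by eventually_elim (simp add: eq')
  next
    assume "\<forall>\<^sub>F s in at_left (\<phi> t). P (\<gamma> s)"
    then have "\<forall>\<^sub>F s in at_left t. P (\<gamma> (\<phi> s))"
      using lim(1) by (rule eventually_compose_filterlim)
    with near(1) show "\<forall>\<^sub>F s in at_left t. P (\<beta> s)"
      by eventually_elim (simp add: eq)
  qed
  have right: "(\<forall>\<^sub>F s in at_right t. P (\<beta> s)) \<longleftrightarrow> (\<forall>\<^sub>F s in at_right (\<phi> t). P (\<gamma> s))" for P
  proof
    assume "\<forall>\<^sub>F s in at_right t. P (\<beta> s)"
    then have "\<forall>\<^sub>F s in at_right (\<phi> t). P (\<beta> (\<psi> s))"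
      using lim'(2) by (rule eventually_compose_filterlim)
    with near'(2) show "\<forall>\<^sub>F s in at_right (\<phi> t). P (\<gamma> s)"
      by eventually_elim (simp add: eq')
  next
    assume "\<forall>\<^sub>F s in at_right (\<phi> t). P (\<gamma> s)"
    then have "\<forall>\<^sub>F s in at_right t. P (\<gamma> (\<phi> s))"
      using lim(2) by (rule eventually_compose_filterlim)
    with near(2) show "\<forall>\<^sub>F s in at_right t. P (\<beta> s)"
      by eventually_elim (simp add: eq)
  qed
  show ?thesis
    unfolding crossing_sign_def Let_def
    by (simp add: left[of "\<lambda>x. 0 < Im ((x - p) / (q - p))"] left[of "\<lambda>x. Im ((x - p) / (q - p)) < 0"]
        right[of "\<lambda>x. 0 < Im ((x - p) / (q - p))"] right[of "\<lambda>x. Im ((x - p) / (q - p)) < 0"])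
qed

lemma coincide_upper:
  assumes "coincide \<gamma> \<beta>" "0 \<le> Im y"
  shows "y \<in> path_image \<gamma> \<longleftrightarrow> y \<in> path_image \<beta>"
proof -
  obtain a b a' b' \<phi> where ab: "0 < a" "a < b" "b < 1" "0 < a'" "a' < b'" "b' < 1"
    and cont: "continuous_on {a..b} \<phi>" and mono: "strict_mono_on {a..b} \<phi>"
    and ends: "\<phi> a = a'" "\<phi> b = b'"
    and eq: "\<And>t. t \<in> {a..b} \<Longrightarrow> \<beta> t = \<gamma> (\<phi> t)"
    and low: "\<And>t. t \<in> {0..1} - {a..b} \<Longrightarrow> Im (\<beta> t) < 0"
      "\<And>s. s \<in> {0..1} - {a'..b'} \<Longrightarrow> Im (\<gamma> s) < 0"
    using assms(1) unfolding coincide_def by blast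
  have img: "\<phi> ` {a..b} = {a'..b'}"
    using strict_mono_on_inv_into(1)[OF cont mono ab(2)] ends by simp
  have "\<beta> ` {a..b} = \<gamma> ` {a'..b'}"
    unfolding img[symmetric] image_image using eq by (intro image_cong) auto
  moreover have "y \<notin> \<beta> ` ({0..1} - {a..b})" "y \<notin> \<gamma> ` ({0..1} - {a'..b'})"
    using low assms(2) by (auto simp: not_less[symmetric] simp del: not_less)
  moreover have "{0..1} = {a..b} \<union> ({0..1} - {a..b})" "{0..1} = {a'..b'} \<union> ({0..1} - {a'..b'})"
    using ab by auto
  ultimately show ?thesis
    unfolding path_image_def by (metis Un_iff image_Un)
qed

text \<open>
  The hypothesis \<open>0 < Im y\<close> is strict because the end points of the common stretch are limits of
  points in the open lower half-plane: they may lie on the real axis, and there only one of the two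
  germs would be shared. That \<open>\<beta>\<close> passes once through \<open>y\<close> implies the same for \<open>\<gamma>\<close>, because the
  common stretch contains all visits of \<open>\<gamma>\<close> to the closed upper half-plane.
\<close>

lemma coincide_vertical_sign:
  assumes "coincide \<gamma> \<beta>" and path: "path \<beta>" and y: "0 < Im y" "y \<in> path_image \<beta>"
    and inj: "\<And>s t. s \<in> {0<..<1} \<Longrightarrow> t \<in> {0<..<1} \<Longrightarrow> \<beta> s = y \<Longrightarrow> \<beta> t = y \<Longrightarrow> s = t"
  shows "vertical_sign \<beta> p y = vertical_sign \<gamma> p y"
proof -
  obtain a b a' b' \<phi> where ab: "0 < a" "a < b" "b < 1" "0 < a'" "a' < b'" "b' < 1"
    and cont: "continuous_on {a..b} \<phi>" and mono: "strict_mono_on {a..b} \<phi>"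
    and ends: "\<phi> a = a'" "\<phi> b = b'"
    and eq: "\<And>t. t \<in> {a..b} \<Longrightarrow> \<beta> t = \<gamma> (\<phi> t)"
    and low: "\<And>t. t \<in> {0..1} - {a..b} \<Longrightarrow> Im (\<beta> t) < 0"
      "\<And>s. s \<in> {0..1} - {a'..b'} \<Longrightarrow> Im (\<gamma> s) < 0"
    using assms(1) unfolding coincide_def by blast
  have img: "\<phi> ` {a..b} = {a'..b'}"
    using strict_mono_on_inv_into(1)[OF cont mono ab(2)] ends by simp
  have Im_cont: "continuous_on S (\<lambda>t. Im (\<beta> t))" if "S \<subseteq> {0..1}" for S
    using path that unfolding path_def by (auto intro!: continuous_intros elim: continuous_on_subset)
  have "Im (\<beta> a) \<le> 0"
  proof (rule continuous_le_on_closure[where S = "{0..<a}" and f = "\<lambda>t. Im (\<beta> t)" and x = a])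
    show "continuous_on (closure {0..<a}) (\<lambda>t. Im (\<beta> t))"
      using ab by (intro Im_cont) auto
    show "a \<in> closure {0..<a}"
      using ab by simp
    show "Im (\<beta> t) \<le> 0" if "t \<in> {0..<a}" for t
      using low(1)[of t] that ab by simp
  qed
  moreover have "Im (\<beta> b) \<le> 0"
  proof (rule continuous_le_on_closure[where S = "{b<..1}" and f = "\<lambda>t. Im (\<beta> t)" and x = b])
    show "continuous_on (closure {b<..1}) (\<lambda>t. Im (\<beta> t))"
      using ab by (intro Im_cont) auto
    show "b \<in> closure {b<..1}"
      using ab by simp
    show "Im (\<beta> t) \<le> 0" if "t \<in> {b<..1}" for t
      using low(1)[of t] that ab by simp
  qed
  moreover have inside: "s \<in> {a..b}" if "s \<in> {0..1}" "\<beta> s = y" for s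
    using low(1)[of s] that y(1) by fastforce
  moreover obtain t where t: "t \<in> {0..1}" "\<beta> t = y"
    using y(2) by (auto simp: path_image_def)
  ultimately have "t \<in> {a..b}" "t \<noteq> a" "t \<noteq> b"
    using y(1) by auto
  then have t_ab: "t \<in> {a<..<b}"
    by simp
  have "passing_time \<beta> y = t"
    unfolding passing_time_def
    using t_ab ab t inj by (intro the_equality) auto
  moreover have "passing_time \<gamma> y = \<phi> t"
    unfolding passing_time_def
  proof (rule the_equality)
    have "\<phi> t \<in> {a'..b'}"
      using img t_ab by auto
    then show "0 < \<phi> t \<and> \<phi> t < 1 \<and> \<gamma> (\<phi> t) = y"
      using ab eq[of t] t t_ab by auto
  next
    fix s assume s: "0 < s \<and> s < 1 \<and> \<gamma> s = y"
    then have "s \<in> {a'..b'}"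
      using low(2)[of s] y(1) by fastforce
    then obtain r where r: "r \<in> {a..b}" "s = \<phi> r"
      unfolding img[symmetric] by blast
    then have "r = t"
      using s eq[of r] t t_ab ab inj[of r t] by auto
    with r show "s = \<phi> t"
      by simp
  qed
  ultimately show ?thesis
    unfolding vertical_sign_def using crossing_sign_reparametrize[OF cont mono t_ab, of \<beta> \<gamma>] eq by simp
qed

section \<open>Intersections of the two families of curves\<close>

lemma in_chopstick_iff:
  assumes "\<bar>z k\<bar> < 1"
  shows "x \<in> chopstick z k \<longleftrightarrow> Re x = z k \<and> 0 \<le> Im x \<and> cmod x \<le> 1"
proof -
  have pos: "0 < sqrt (1 - (z k)\<^sup>2)"
    using assms by (simp add: abs_square_less_1)
  have "x \<in> chopstick z k \<longleftrightarrow> Re x = z k \<and> 0 \<le> Im x \<and> Im x \<le> sqrt (1 - (z k)\<^sup>2)"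
    using pos
    by (auto simp: chopstick_def upper_point_def closed_segment_same_Re closed_segment_eq_real_ivl)
  also have "\<dots> \<longleftrightarrow> Re x = z k \<and> 0 \<le> Im x \<and> cmod x \<le> 1"
  proof -
    have "Im x \<le> sqrt (1 - (z k)\<^sup>2) \<longleftrightarrow> (z k)\<^sup>2 + (Im x)\<^sup>2 \<le> 1" if "0 \<le> Im x"
      using that real_sqrt_le_iff[of "(Im x)\<^sup>2" "1 - (z k)\<^sup>2"] by auto
    moreover have "cmod x \<le> 1 \<longleftrightarrow> (Re x)\<^sup>2 + (Im x)\<^sup>2 \<le> 1"
      by (simp add: cmod_def)
    ultimately show ?thesis
      by auto
  qed
  finally show ?thesis .
qed

text \<open>
  The alternatives are the two vertical legs over and below the puncture, the upper semicircle, the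
  right-hand vertical leg and the lower semicircle. All but the two legs stay outside the open
  disk and away from the rectangles around the bridges.
\<close>

lemma underbridge_cases:
  assumes "\<bar>z k\<bar> < 1" and "x \<in> path_image (underbridge z k)"
  shows "Re x = z k \<and> (0 \<le> Im x \<or> Im x \<le> - 2) \<or> 1 \<le> Im x \<or> 3 \<le> Re x \<or> Im x \<le> - 3"
proof -
  have upper: "1 \<le> Im y" if "y \<in> path_image (part_circlepath (2 + \<i>) (2 - z k) pi 0)" for y
  proof -
    have "y \<in> (\<lambda>\<theta>. 2 + \<i> + (2 - z k) * exp (\<i> * of_real \<theta>)) ` {0..pi}"
      using that by (simp add: path_image_part_circlepath' closed_segment_eq_real_ivl cis_conv_exp pi_gt_zero[THEN not_le[THEN iffD2]])
    then obtain \<theta> where "0 \<le> \<theta>" "\<theta> \<le> pi" and y: "y = 2 + \<i> + (2 - z k) * exp (\<i> * of_real \<theta>)"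
      by auto
    then have "0 \<le> sin \<theta>"
      by (simp add: sin_ge_zero)
    then show ?thesis
      using assms(1) by (simp add: y Im_exp)
  qed
  have lower: "Im y \<le> - 3" if "y \<in> path_image (part_circlepath (2 - 3 * \<i>) (2 - z k) 0 (- pi))" for y
  proof -
    have "y \<in> (\<lambda>\<theta>. 2 - 3 * \<i> + (2 - z k) * exp (\<i> * of_real \<theta>)) ` {- pi..0}"
      using that by (simp add: path_image_part_circlepath' closed_segment_eq_real_ivl cis_conv_exp pi_gt_zero[THEN not_le[THEN iffD2]])
    then obtain \<theta> where "- pi \<le> \<theta>" "\<theta> \<le> 0" and y: "y = 2 - 3 * \<i> + (2 - z k) * exp (\<i> * of_real \<theta>)"
      by auto
    then have "sin \<theta> \<le> 0"
      using sin_ge_zero[of "- \<theta>"] by simp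
    then show ?thesis
      using assms(1) by (simp add: y Im_exp mult_nonneg_nonpos)
  qed
  have "x \<in> closed_segment (of_real (z k)) (of_real (z k) + \<i>)
      \<or> x \<in> path_image (part_circlepath (2 + \<i>) (2 - z k) pi 0)
      \<or> x \<in> closed_segment (of_real (4 - z k) + \<i>) (of_real (4 - z k) - 3 * \<i>)
      \<or> x \<in> path_image (part_circlepath (2 - 3 * \<i>) (2 - z k) 0 (- pi))
      \<or> x \<in> closed_segment (of_real (z k) - 3 * \<i>) (w_point z k)"
    using path_image_join_subset assms(2) unfolding underbridge_def path_image_linepath[symmetric]
    by blast
  then show ?thesis
    using upper lower assms(1)
    by (auto simp: closed_segment_same_Re w_point_def closed_segment_eq_real_ivl)
qed

lemma underbridge_legs:
  assumes "Re x = z k" and "0 \<le> Im x \<and> Im x \<le> 1 \<or> - 3 \<le> Im x \<and> Im x \<le> - 2"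
  shows "x \<in> path_image (underbridge z k)"
proof -
  have "exp (\<i> * complex_of_real pi) = -1" "exp (- (\<i> * complex_of_real pi)) = -1"
    by (simp_all add: exp_minus)
  then have "path_image (underbridge z k) \<supseteq>
      closed_segment (of_real (z k)) (of_real (z k) + \<i>) \<union>
      closed_segment (of_real (z k) - 3 * \<i>) (w_point z k)"
    unfolding underbridge_def
    by (subst path_image_join, simp)+ auto
  then show ?thesis
    using assms
    by (auto simp: closed_segment_same_Re w_point_def closed_segment_eq_real_ivl)
qed

text \<open>
  Here \<open>\<rho>\<close> is the representative of the braid that carries the \<open>\<beta>\<close>-curves. The noodle images
  \<open>\<gamma>\<close> may belong to another one: an isotopy may be needed to make the two kinds of curves coincide.
\<close>

locale bridge_diagram =
  fixes n :: nat and z :: "nat \<Rightarrow> real" and d h :: real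
    and \<rho> :: "complex \<Rightarrow> complex" and \<gamma> \<beta> :: "nat \<Rightarrow> real \<Rightarrow> complex"
  assumes punctures: "punctures n z"
    and braid: "braid_homeo n z \<rho>"
    and beta_eq: "\<beta> = beta_curve z d \<rho>"
    and thin: "thin_bridges n z d h \<beta>"
    and coincide: "j \<in> {2..n} \<Longrightarrow> coincide (\<gamma> j) (\<beta> j)"
begin

abbreviation H :: heegaard where
  "H \<equiv> heegaard_diagram n z h \<beta>"

abbreviation frame :: "nat \<Rightarrow> real \<Rightarrow> complex" where
  "frame j \<equiv> rectpath (w_point z j - Complex d d) (of_real (z j) + Complex d d)"

lemma h_pos: "0 < h" and h_less_d: "h < d"
  using thin by (auto simp: thin_bridges_def)

lemma d_pos: "0 < d"
  using h_pos h_less_d by simp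

lemma d_less_1:
  assumes "j \<in> {1..n}"
  shows "d < 1"
proof -
  have "cmod (Complex (\<bar>z j\<bar> + d) d) < 1"
    using thin assms by (auto simp: thin_bridges_def)
  then show ?thesis
    using abs_Im_le_cmod[of "Complex (\<bar>z j\<bar> + d) d"] by simp
qed

lemma abs_z_less_1: "j \<in> {1..n} \<Longrightarrow> \<bar>z j\<bar> < 1"
  using punctures by (force simp: punctures_def abs_less_iff)

lemma bridges_apart: "i \<in> {1..n} \<Longrightarrow> j \<in> {1..n} \<Longrightarrow> i \<noteq> j \<Longrightarrow> 2 * d < \<bar>z i - z j\<bar>"
  using thin by (auto simp: thin_bridges_def)

lemma in_frame_iff:
  "x \<in> path_image (frame j) \<longleftrightarrow>
     \<bar>Re x - z j\<bar> \<le> d \<and> - 2 - d \<le> Im x \<and> Im x \<le> d \<and>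
     \<not> (\<bar>Re x - z j\<bar> < d \<and> - 2 - d < Im x \<and> Im x < d)"
  using d_pos
  by (subst path_image_rectpath_cbox_minus_box)
     (auto simp: w_point_def in_cbox_complex_iff in_box_complex_iff)

lemma path_image_beta: "path_image (\<beta> j) = \<rho> ` path_image (frame j)"
  by (simp add: beta_eq beta_curve_def path_image_compose)

lemma inj_rho: "inj \<rho>"
  using braid by (auto simp: braid_homeo_def homeomorphism_def intro: inj_on_inverseI)

lemma rho_outside: "1 \<le> cmod x \<Longrightarrow> \<rho> x = x"
  using braid by (auto simp: braid_homeo_def)

text \<open>Since \<open>\<rho>\<close> is injective and fixes the outside of the disk pointwise, it preserves the disk.\<close>

lemma rho_outside_iff: "1 \<le> cmod (\<rho> x) \<longleftrightarrow> 1 \<le> cmod x"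
  by (metis inj_rho injD rho_outside)

lemma beta_outside:
  assumes "1 \<le> cmod x"
  shows "x \<in> path_image (\<beta> j) \<longleftrightarrow> x \<in> path_image (frame j)"
  using assms by (auto simp: path_image_beta image_iff rho_outside rho_outside_iff)
    (metis rho_outside rho_outside_iff)

lemma frame_outside:
  assumes "j \<in> {1..n}" and "x \<in> path_image (frame j)" and "1 \<le> cmod x"
  shows "Im x < 0"
proof (rule ccontr)
  assume "\<not> Im x < 0"
  then have "\<bar>Re x\<bar> \<le> \<bar>z j\<bar> + d" "\<bar>Im x\<bar> \<le> d"
    using assms(2) by (auto simp: in_frame_iff)
  then have "cmod x \<le> cmod (Complex (\<bar>z j\<bar> + d) d)"
    using power_mono[of "\<bar>Re x\<bar>" "\<bar>z j\<bar> + d" 2] power_mono[of "\<bar>Im x\<bar>" d 2]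
    by (simp add: cmod_def)
  also have "\<dots> < 1"
    using thin assms(1) by (auto simp: thin_bridges_def)
  finally show False
    using assms(3) by simp
qed

lemma frames_disjoint:
  assumes "i \<in> {1..n}" "j \<in> {1..n}" "x \<in> path_image (frame i)" "x \<in> path_image (frame j)"
  shows "i = j"
proof (rule ccontr)
  assume "i \<noteq> j"
  then have "2 * d < \<bar>z i - z j\<bar>"
    using assms bridges_apart by blast
  moreover have "\<bar>Re x - z i\<bar> \<le> d" "\<bar>Re x - z j\<bar> \<le> d"
    using assms by (auto simp: in_frame_iff)
  ultimately show False
    by linarith
qed

lemma beta_disjoint:
  assumes "i \<in> {2..n}" "j \<in> {2..n}" "x \<in> path_image (\<beta> i)" "x \<in> path_image (\<beta> j)"
  shows "i = j"
  using assms frames_disjoint[of i j] inj_rho by (auto simp: path_image_beta dest: injD)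

lemma chopstick_iff:
  "k \<in> {2..n} \<Longrightarrow> x \<in> chopstick z k \<longleftrightarrow> Re x = z k \<and> 0 \<le> Im x \<and> cmod x \<le> 1"
  using abs_z_less_1[of k] by (intro in_chopstick_iff) auto

lemma anchor_simps [simp]: "Re (anchor z d j) = z j" "Im (anchor z d j) = - 2 - d"
  by (auto simp: anchor_def w_point_def)

lemma z_inj: "i \<in> {2..n} \<Longrightarrow> j \<in> {2..n} \<Longrightarrow> z i = z j \<Longrightarrow> i = j"
  using bridges_apart[of i j] d_pos by force

lemma cmod_anchor: "1 \<le> cmod (anchor z d j)"
  using abs_Im_le_cmod[of "anchor z d j"] d_pos by simp

lemma anchor_in_beta: "anchor z d j \<in> path_image (\<beta> j)"
  using d_pos by (simp add: beta_outside cmod_anchor in_frame_iff)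

lemma anchor_notin_chopstick: "j \<in> {2..n} \<Longrightarrow> k \<in> {2..n} \<Longrightarrow> anchor z d j \<notin> chopstick z k"
  using d_pos by (simp add: chopstick_iff)

lemma beta_avoids_disks:
  assumes "i \<in> {2..n}" "j \<in> {2..n}" "x \<in> path_image (\<beta> j)"
  shows "x \<notin> cball (of_real (z i)) h" "x \<notin> cball (w_point z i) h"
  using thin assms unfolding thin_bridges_def by blast+

lemma in_beta_iff: "p \<in> beta H j \<longleftrightarrow> (\<exists>x. p = Sphere (Some x) \<and> x \<in> path_image (\<beta> j))"
  by (auto simp: heegaard_diagram_def)

text \<open>
  Outside the disk a \<open>\<beta>\<close>-curve is the lower part of its rectangle, and the only part of an
  underbridge that comes near it is the last leg. Inside the disk an underbridge is a chopstick. The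
  handles and the disks that they replace do not meet the \<open>\<beta>\<close>-curves.
\<close>

lemma in_alpha_iff:
  assumes "j \<in> {2..n}" "k \<in> {2..n}" "x \<in> path_image (\<beta> j)"
  shows "Sphere (Some x) \<in> alpha H k \<longleftrightarrow> x \<in> chopstick z k \<or> j = k \<and> x = anchor z d j"
proof -
  have k: "\<bar>z k\<bar> < 1" and d1: "d < 1"
    using abs_z_less_1[of k] d_less_1[of k] assms by auto
  have "Sphere (Some x) \<in> alpha H k \<longleftrightarrow> x \<in> path_image (underbridge z k)"
    using beta_avoids_disks[OF assms(2,1,3)] by (auto simp: heegaard_diagram_def)
  also have "\<dots> \<longleftrightarrow> x \<in> chopstick z k \<or> j = k \<and> x = anchor z d j"
  proof
    assume under: "x \<in> path_image (underbridge z k)"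
    show "x \<in> chopstick z k \<or> j = k \<and> x = anchor z d j"
    proof (cases "1 \<le> cmod x")
      case True
      then have frame: "x \<in> path_image (frame j)"
        using assms beta_outside by blast
      then have neg: "Im x < 0"
        using assms True by (intro frame_outside[of j]) auto
      have "\<bar>z j\<bar> < 1"
        using assms abs_z_less_1[of j] by auto
      moreover have bounds: "\<bar>Re x - z j\<bar> \<le> d" "- 2 - d \<le> Im x"
        using frame by (auto simp: in_frame_iff)
      ultimately have leg: "Re x = z k" "Im x \<le> - 2"
        using underbridge_cases[OF k under] neg d1 by linarith+
      have "j = k"
      proof (rule ccontr)
        assume "j \<noteq> k"
        then have "2 * d < \<bar>z j - z k\<bar>"
          using assms bridges_apart[of j k] by auto
        with leg bounds d_pos show False
          by linarith
      qed
      moreover have "Im x = - 2 - d"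
        using frame leg \<open>j = k\<close> d_pos by (auto simp: in_frame_iff)
      ultimately show ?thesis
        using leg by (auto simp: complex_eq_iff)
    next
      case False
      then have "\<bar>Re x\<bar> < 1" "\<bar>Im x\<bar> < 1"
        using abs_Re_le_cmod[of x] abs_Im_le_cmod[of x] by linarith+
      with k under have "Re x = z k \<and> 0 \<le> Im x"
        using underbridge_cases[OF k under] by linarith
      with False assms show ?thesis
        by (simp add: chopstick_iff)
    qed
  next
    assume "x \<in> chopstick z k \<or> j = k \<and> x = anchor z d j"
    then show "x \<in> path_image (underbridge z k)"
    proof
      assume "x \<in> chopstick z k"
      then show ?thesis
        using assms abs_Im_le_cmod[of x] by (intro underbridge_legs) (auto simp: chopstick_iff)
    next
      assume "j = k \<and> x = anchor z d j"
      then show ?thesis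
        using d_pos d1 by (intro underbridge_legs) auto
    qed
  qed
  finally show ?thesis .
qed

lemma chopstick_disjoint:
  "k \<in> {2..n} \<Longrightarrow> k' \<in> {2..n} \<Longrightarrow> x \<in> chopstick z k \<Longrightarrow> x \<in> chopstick z k' \<Longrightarrow> k = k'"
  using z_inj by (simp add: chopstick_iff)

lemma gamma_iff_beta:
  assumes "j \<in> {2..n}" "k \<in> {2..n}" "x \<in> chopstick z k"
  shows "x \<in> path_image (\<gamma> j) \<longleftrightarrow> x \<in> path_image (\<beta> j)"
  using assms coincide_upper[OF coincide] by (simp add: chopstick_iff)

section \<open>Local signs on chopsticks and at anchors\<close>

lemma continuous_rho: "continuous_on S \<rho>"
  using braid by (auto simp: braid_homeo_def homeomorphism_def intro: continuous_on_subset)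

lemma simple_path_frame: "simple_path (reversepath (frame j))"
  using d_pos by (intro simple_path_reversepath simple_path_rectpath) (auto simp: w_point_def)

lemma path_beta: "path (\<beta> j)"
  unfolding beta_eq beta_curve_def
  using simple_path_frame by (intro path_continuous_image continuous_rho simple_path_imp_path)

lemma beta_inj:
  assumes "s \<in> {0<..<1}" "t \<in> {0<..<1}" "\<beta> j s = \<beta> j t"
  shows "s = t"
proof -
  have "reversepath (frame j) s = reversepath (frame j) t"
    using assms(3) injD[OF inj_rho] by (simp add: beta_eq beta_curve_def)
  then show ?thesis
    using simple_path_frame[of j] assms(1,2) by (force simp: simple_path_def loop_free_def)
qed

text \<open>
  The only point of a chopstick that is not strictly above the real axis is its puncture, and the
  \<open>\<beta>\<close>-curves keep the distance \<open>h\<close> from it.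
\<close>

lemma vertical_sign_chopstick:
  assumes "j \<in> {2..n}" "k \<in> {2..n}" "x \<in> path_image (\<beta> j)" "x \<in> chopstick z k"
  shows "vertical_sign (\<beta> j) (z k) x = vertical_sign (\<gamma> j) (z k) x"
proof (rule coincide_vertical_sign)
  have "x \<noteq> of_real (z k)"
    using beta_avoids_disks(1)[OF assms(2,1,3)] h_pos by auto
  then show "0 < Im x"
    using assms(2,4) by (auto simp: chopstick_iff complex_eq_iff)
  show "s = t" if "s \<in> {0<..<1}" "t \<in> {0<..<1}" "\<beta> j s = x" "\<beta> j t = x" for s t
    using beta_inj[of s t j] that by simp
qed (use assms coincide path_beta in auto)

text \<open>
  The lower side of the rectangle is the last one of the clockwise circuit. It lies outside the
  disk, where \<open>\<rho>\<close> is the identity. Among the four sides, the parametrization of joined paths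
  gives it half of the unit interval.
\<close>

lemma beta_lower_side:
  assumes "t \<in> {1/2..1}"
  shows "\<beta> j t = Complex (z j + d * (3 - 4 * t)) (- 2 - d)"
proof -
  let ?x = "Complex (z j + d * (3 - 4 * t)) (- 2 - d)"
  have "frame j (1 - t) = ?x"
    using assms
    by (auto simp: rectpath_def Let_def joinpaths_def linepath_def w_point_def complex_eq_iff
        scaleR_conv_of_real algebra_simps)
  moreover have "1 \<le> cmod ?x"
    using abs_Im_le_cmod[of ?x] d_pos by simp
  ultimately show ?thesis
    by (simp add: beta_eq beta_curve_def reversepath_def rho_outside)
qed

lemma vertical_sign_anchor: "vertical_sign (\<beta> j) (z j) (anchor z d j) = - 1"
proof -
  \<comment> \<open>The lower side is traversed during \<open>[1/2, 1]\<close> and the anchor is its midpoint.\<close>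
  have at: "\<beta> j (3/4) = anchor z d j"
    by (simp add: beta_lower_side complex_eq_iff)
  have time: "passing_time (\<beta> j) (anchor z d j) = 3/4"
    unfolding passing_time_def
  proof (rule the_equality)
    fix t assume "0 < t \<and> t < 1 \<and> \<beta> j t = anchor z d j"
    then show "t = 3/4"
      using at beta_inj[of t "3/4" j] by simp
  qed (simp add: at)
  have side: "Im ((\<beta> j t - of_real (z j)) / ((of_real (z j) + \<i>) - of_real (z j))) = d * (4 * t - 3)"
    if "t \<in> {1/2..1}" for t
    using that by (simp add: beta_lower_side Im_divide algebra_simps)
  have "\<forall>\<^sub>F t in at_left (3/4). t \<in> {1/2<..<3/4::real}"
    by (rule eventually_at_leftI[of "1/2"]) auto
  then have "\<forall>\<^sub>F t in at_left (3/4).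
      Im ((\<beta> j t - of_real (z j)) / ((of_real (z j) + \<i>) - of_real (z j))) < 0"
    by eventually_elim (subst side, use d_pos in \<open>auto simp: mult_pos_neg\<close>)
  moreover have "\<not> (\<forall>\<^sub>F t in at_left (3/4).
      Im ((\<beta> j t - of_real (z j)) / ((of_real (z j) + \<i>) - of_real (z j))) > 0)"
  proof
    assume "\<forall>\<^sub>F t in at_left (3/4).
      Im ((\<beta> j t - of_real (z j)) / ((of_real (z j) + \<i>) - of_real (z j))) > 0"
    with calculation have "\<forall>\<^sub>F t in at_left (3/4::real). False"
      by eventually_elim simp
    then show False
      by simp
  qed
  moreover have "\<forall>\<^sub>F t in at_right (3/4). t \<in> {3/4<..<1::real}"
    by (rule eventually_at_rightI[of _ 1]) auto
  then have "\<forall>\<^sub>F t in at_right (3/4).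
      Im ((\<beta> j t - of_real (z j)) / ((of_real (z j) + \<i>) - of_real (z j))) > 0"
    by eventually_elim (subst side, use d_pos in auto)
  ultimately show ?thesis
    unfolding vertical_sign_def crossing_sign_def time Let_def by simp
qed

section \<open>Generators as permutations with chosen intersection points\<close>

text \<open>
  A state selects on every \<open>\<beta>\<close>-curve a point where it meets some \<open>\<alpha>\<close>-curve, such that every
  \<open>\<alpha>\<close>-curve is used once. Generators are recorded only as sets of points, and summands only as sets
  together with a permutation of positions; both are compared with states.
\<close>

definition is_state :: "(nat \<Rightarrow> nat) \<Rightarrow> (nat \<Rightarrow> complex) \<Rightarrow> bool" where
  "is_state \<tau> x \<longleftrightarrow> \<tau> permutes {2..n} \<and>
     (\<forall>r\<in>{2..n}. x r \<in> path_image (\<beta> r) \<and>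
        (x r \<in> chopstick z (\<tau> r) \<or> \<tau> r = r \<and> x r = anchor z d r))"

definition points :: "(nat \<Rightarrow> complex) \<Rightarrow> surface_point set" where
  "points x = (\<lambda>r. Sphere (Some (x r))) ` {2..n}"

lemma state_in_alpha_iff:
  assumes "is_state \<tau> x" "r \<in> {2..n}" "k \<in> {2..n}"
  shows "Sphere (Some (x r)) \<in> alpha H k \<longleftrightarrow> k = \<tau> r"
proof -
  have "\<tau> r \<in> {2..n}"
    using assms by (auto simp: is_state_def permutes_in_image simp del: atLeastAtMost_iff)
  moreover have "x r \<in> path_image (\<beta> r)"
    "x r \<in> chopstick z (\<tau> r) \<or> \<tau> r = r \<and> x r = anchor z d r"
    using assms by (auto simp: is_state_def)
  ultimately show ?thesis
    using assms(2,3) in_alpha_iff[of r k "x r"] anchor_notin_chopstick[of r k]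
      anchor_notin_chopstick[of r "\<tau> r"] chopstick_disjoint[of k "\<tau> r" "x r"]
    by (auto simp del: atLeastAtMost_iff)
qed

lemma state_in_beta_iff:
  assumes "is_state \<tau> x" "r \<in> {2..n}" "j \<in> {2..n}"
  shows "x r \<in> path_image (\<beta> j) \<longleftrightarrow> j = r"
  using assms beta_disjoint by (auto simp: is_state_def simp del: atLeastAtMost_iff)

text \<open>
  The curves of each family are disjoint, so the set of points determines which point lies on which
  curve: the indexing \<open>x\<close> and the permutation \<open>\<tau>\<close> can be read off from \<open>points x\<close>.
\<close>

lemma generator_of_state:
  assumes "is_state \<tau> x"
  shows "points x \<in> generators H"
    and "\<And>r. r \<in> {2..n} \<Longrightarrow> generator_point \<beta> (points x) r = x r"
    and "generator_perm H (points x) = \<tau>"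
proof -
  have perm: "\<tau> permutes {2..n}"
    using assms by (simp add: is_state_def)
  have idx [simp]: "indices H = {2..n}"
    by (simp add: heegaard_diagram_def)
  have alpha: "Sphere (Some (x r)) \<in> alpha H k \<longleftrightarrow> k = \<tau> r" if "r \<in> {2..n}" "k \<in> {2..n}" for r k
    using state_in_alpha_iff[OF assms that] .
  have beta: "Sphere (Some (x r)) \<in> beta H j \<longleftrightarrow> j = r" if "r \<in> {2..n}" "j \<in> {2..n}" for r j
    using state_in_beta_iff[OF assms that] by (simp add: in_beta_iff)
  have inj: "inj_on (\<lambda>r. Sphere (Some (x r))) {2..n}"
    using beta by (metis (no_types, lifting) inj_onI)
  have \<tau>_in: "\<tau> r \<in> {2..n}" if "r \<in> {2..n}" for r
    using perm that by (simp only: permutes_in_image)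
  have "points x \<subseteq> (\<Union>k\<in>{2..n}. alpha H k) \<inter> (\<Union>j\<in>{2..n}. beta H j)"
    unfolding points_def using alpha beta \<tau>_in by blast
  moreover have "\<exists>!p. p \<in> points x \<inter> alpha H k" if k: "k \<in> {2..n}" for k
  proof -
    obtain r where r: "r \<in> {2..n}" "\<tau> r = k"
      using k perm by (metis permutes_def permutes_in_image)
    have "r' = r" if "r' \<in> {2..n}" "k = \<tau> r'" for r'
      using that r permutes_inj[OF perm] by (metis injD)
    then show ?thesis
      unfolding points_def using r k alpha by blast
  qed
  moreover have "\<exists>!p. p \<in> points x \<inter> beta H j" if j: "j \<in> {2..n}" for j
    unfolding points_def using j beta by blast
  moreover have "card (points x) = card {2..n}" "finite (points x)"
    unfolding points_def using inj by (auto simp: card_image)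
  ultimately show "points x \<in> generators H"
    unfolding generators_def by simp
  show "generator_point \<beta> (points x) r = x r" if r: "r \<in> {2..n}" for r
    unfolding generator_point_def
  proof (rule the_equality)
    show "Sphere (Some (x r)) \<in> points x \<and> x r \<in> path_image (\<beta> r)"
      using r assms by (simp add: points_def is_state_def)
    fix y assume "Sphere (Some y) \<in> points x \<and> y \<in> path_image (\<beta> r)"
    then show "y = x r"
      using r state_in_beta_iff[OF assms] by (auto simp: points_def simp del: atLeastAtMost_iff)
  qed
  show "generator_perm H (points x) = \<tau>"
    unfolding generator_perm_def idx
  proof (rule the_equality)
    show "\<tau> permutes {2..n} \<and> (\<forall>r\<in>{2..n}. \<exists>p\<in>points x. p \<in> beta H r \<inter> alpha H (\<tau> r))"
      using perm alpha beta \<tau>_in unfolding points_def by blast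
  next
    fix \<sigma> assume \<sigma>: "\<sigma> permutes {2..n} \<and> (\<forall>r\<in>{2..n}. \<exists>p\<in>points x. p \<in> beta H r \<inter> alpha H (\<sigma> r))"
    show "\<sigma> = \<tau>"
    proof
      fix r
      show "\<sigma> r = \<tau> r"
      proof (cases "r \<in> {2..n}")
        case True
        then have "\<sigma> r \<in> {2..n}"
          using \<sigma> by (simp only: permutes_in_image)
        then show ?thesis
          using True \<sigma> alpha beta unfolding points_def by blast
      next
        case False
        then show ?thesis
          using \<sigma> perm by (metis permutes_not_in)
      qed
    qed
  qed
qed

text \<open>
  Exactly one point on each \<open>\<beta>\<close>-curve gives the indexing \<open>x\<close>. Exactly one point on each
  \<open>\<alpha>\<close>-curve makes the assignment of \<open>\<alpha>\<close>-curves to these points injective, hence a permutation.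
\<close>

lemma generator_obtains_state:
  assumes "X \<in> generators H"
  obtains \<tau> x where "is_state \<tau> x" "X = points x"
proof -
  have idx [simp]: "indices H = {2..n}"
    by (simp add: heegaard_diagram_def)
  have sub: "X \<subseteq> (\<Union>k\<in>{2..n}. alpha H k) \<inter> (\<Union>j\<in>{2..n}. beta H j)"
    and ex1_alpha: "\<And>k. k \<in> {2..n} \<Longrightarrow> \<exists>!p. p \<in> X \<inter> alpha H k"
    and ex1_beta: "\<And>j. j \<in> {2..n} \<Longrightarrow> \<exists>!p. p \<in> X \<inter> beta H j"
    using assms unfolding generators_def by auto
  have "\<forall>r\<in>{2..n}. \<exists>y. Sphere (Some y) \<in> X \<and> y \<in> path_image (\<beta> r)"
    using ex1_beta unfolding in_beta_iff[symmetric] Int_iff by (metis in_beta_iff)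
  then obtain x where x: "\<And>r. r \<in> {2..n} \<Longrightarrow> Sphere (Some (x r)) \<in> X"
      "\<And>r. r \<in> {2..n} \<Longrightarrow> x r \<in> path_image (\<beta> r)"
    by metis
  have x_beta: "Sphere (Some (x r)) \<in> beta H r" if "r \<in> {2..n}" for r
    using x(2)[OF that] by (simp add: in_beta_iff)
  have X_eq: "X = points x"
  proof
    show "points x \<subseteq> X"
      using x(1) unfolding points_def by blast
    show "X \<subseteq> points x"
    proof
      fix p assume p: "p \<in> X"
      then obtain j where j: "j \<in> {2..n}" "p \<in> beta H j"
        using sub by blast
      then have "p = Sphere (Some (x j))"
        using ex1_beta[OF j(1)] p x(1)[OF j(1)] x_beta[OF j(1)] by blast
      then show "p \<in> points x"
        using j by (simp add: points_def)
    qed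
  qed
  have "\<forall>r\<in>{2..n}. \<exists>k\<in>{2..n}. Sphere (Some (x r)) \<in> alpha H k"
    using x(1) sub by blast
  then obtain \<tau>\<^sub>0 where \<tau>\<^sub>0: "\<And>r. r \<in> {2..n} \<Longrightarrow> \<tau>\<^sub>0 r \<in> {2..n}"
      "\<And>r. r \<in> {2..n} \<Longrightarrow> Sphere (Some (x r)) \<in> alpha H (\<tau>\<^sub>0 r)"
    by metis
  have inj: "inj_on \<tau>\<^sub>0 {2..n}"
  proof (rule inj_onI)
    fix r s assume rs: "r \<in> {2..n}" "s \<in> {2..n}" "\<tau>\<^sub>0 r = \<tau>\<^sub>0 s"
    then have "Sphere (Some (x r)) = Sphere (Some (x s))"
      using ex1_alpha[OF \<tau>\<^sub>0(1)[OF rs(1)]] \<tau>\<^sub>0(2) x(1) by (metis IntI)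
    then show "r = s"
      using rs x(2) beta_disjoint by (metis option.inject surface_point.inject(1))
  qed
  define \<tau> where "\<tau> r = (if r \<in> {2..n} then \<tau>\<^sub>0 r else r)" for r
  have "bij_betw \<tau>\<^sub>0 {2..n} {2..n}"
    using inj \<tau>\<^sub>0(1) by (metis bij_betw_def endo_inj_surj finite_atLeastAtMost image_subsetI)
  moreover have "bij_betw \<tau> {2..n} {2..n} = bij_betw \<tau>\<^sub>0 {2..n} {2..n}"
    by (rule bij_betw_cong) (simp only: \<tau>_def if_True)
  ultimately have "bij_betw \<tau> {2..n} {2..n}"
    by simp
  then have "\<tau> permutes {2..n}"
    by (rule bij_imp_permutes) (simp only: \<tau>_def if_False)
  moreover have "x r \<in> chopstick z (\<tau> r) \<or> \<tau> r = r \<and> x r = anchor z d r" if r: "r \<in> {2..n}" for r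
  proof -
    have "\<tau> r = \<tau>\<^sub>0 r"
      using r by (simp only: \<tau>_def if_True)
    then show ?thesis
      using in_alpha_iff[OF r \<tau>\<^sub>0(1)[OF r] x(2)[OF r]] \<tau>\<^sub>0(2)[OF r] by auto
  qed
  ultimately have "is_state \<tau> x"
    using x(2) by (simp add: is_state_def)
  then show thesis
    using X_eq that by blast
qed

end

section \<open>Summands as partial generators\<close>

lemma bij_betw_entry: "finite J \<Longrightarrow> bij_betw (entry J) {..<card J} J"
  unfolding entry_def by (rule bij_betw_nth) auto

text \<open>
  The state sum permutes the positions \<open>0, 1, \<dots>\<close> in the increasing enumeration of \<open>J\<close>, whereas
  generators permute the indices themselves. The result is the identity outside \<open>J\<close>, so it is also
  a permutation of every larger index set, with the same sign.
\<close>

definition transported :: "nat set \<Rightarrow> (nat \<Rightarrow> nat) \<Rightarrow> nat \<Rightarrow> nat" where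
  "transported J = map_permutation {..<card J} (entry J)"

lemma bij_betw_transported:
  assumes "finite J"
  shows "bij_betw (transported J) {\<sigma>. \<sigma> permutes {..<card J}} {\<tau>. \<tau> permutes J}"
proof -
  let ?I = "{..<card J}" and ?g = "inv_into {..<card J} (entry J)"
  note bij = bij_betw_entry[OF assms]
  note bij' = bij_betw_inv_into[OF bij]
  show ?thesis
    unfolding transported_def
  proof (rule bij_betw_byWitness[where f' = "map_permutation J ?g"])
    show "\<forall>\<sigma>\<in>{\<sigma>. \<sigma> permutes ?I}. map_permutation J ?g (map_permutation ?I (entry J) \<sigma>) = \<sigma>"
      using bij bij_betw_inv_into_left[OF bij] by (auto intro!: map_permutation_compose_inv)
    show "\<forall>\<tau>\<in>{\<tau>. \<tau> permutes J}. map_permutation ?I (entry J) (map_permutation J ?g \<tau>) = \<tau>"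
      using bij' bij_betw_inv_into_right[OF bij] by (auto intro!: map_permutation_compose_inv)
  qed (use bij bij' in \<open>auto intro!: map_permutation_permutes\<close>)
qed

lemma transported_permutes: "finite J \<Longrightarrow> \<sigma> permutes {..<card J} \<Longrightarrow> transported J \<sigma> permutes J"
  using bij_betw_transported by (blast dest: bij_betwE)

lemma transported_entry:
  "finite J \<Longrightarrow> i < card J \<Longrightarrow> transported J \<sigma> (entry J i) = entry J (\<sigma> i)"
  using bij_betw_entry[of J] by (simp add: transported_def map_permutation_apply bij_betw_def)

lemma sign_transported:
  "finite J \<Longrightarrow> \<sigma> permutes {..<card J} \<Longrightarrow> sign (transported J \<sigma>) = sign \<sigma>"
  using bij_betw_entry[of J] by (simp add: transported_def sign_map_permutation bij_betw_def)

lemma prod_monomial: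
  "finite A \<Longrightarrow> (\<Prod>r\<in>A. of_int (c r) * monomial (of_int (s r)) 1)
     = monomial (of_int (\<Sum>r\<in>A. s r)) (of_int (\<Prod>r\<in>A. c r))"
  by (induction A rule: finite_induct)
     (simp_all add: single_of_int[symmetric] mult_single del: single_of_int)

context bridge_diagram
begin

text \<open>
  A summand has points only on the curves with index in \<open>J\<close>; each remaining pair
  \<open>\<alpha>\<^sub>j\<close>, \<open>\<beta>\<^sub>j\<close> receives its anchor point.
\<close>

definition generator_of :: "nat set \<times> (nat \<Rightarrow> nat) \<times> complex set \<Rightarrow> surface_point set" where
  "generator_of = (\<lambda>(J, \<sigma>, Y). (\<lambda>y. Sphere (Some y)) ` (Y \<union> anchor z d ` ({2..n} - J)))"

lemma points_eq_image: "points x = (\<lambda>y. Sphere (Some y)) ` x ` {2..n}"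
  by (simp add: points_def image_image)

text \<open>
  Anchors never lie on chopsticks, so \<open>J\<close> is recovered from the state as the set of indices whose
  point is not an anchor.
\<close>

lemma summand_obtains_state:
  assumes "(J, \<sigma>, Y) \<in> summands n z \<gamma>"
  obtains x where "is_state (transported J \<sigma>) x" "J = {r \<in> {2..n}. x r \<noteq> anchor z d r}" "Y = x ` J"
    "\<And>r. r \<in> J \<Longrightarrow> x r \<in> chopstick z (transported J \<sigma> r)"
    "generator_of (J, \<sigma>, Y) = points x"
proof -
  have J: "J \<subseteq> {2..n}" and \<sigma>: "\<sigma> permutes {..<card J}" and "Y \<in> Gamma_set z \<gamma> J J \<sigma>"
    using assms by (auto simp: summands_def)
  then obtain y where Y: "Y = y ` {..<card J}"
    and y: "\<And>i. i < card J \<Longrightarrow> y i \<in> path_image (\<gamma> (entry J i)) \<inter> chopstick z (entry J (\<sigma> i))"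
    unfolding Gamma_set_def by blast
  have fin: "finite J"
    using J finite_subset by blast
  define \<tau> where "\<tau> = transported J \<sigma>"
  have \<tau>: "\<tau> permutes J"
    unfolding \<tau>_def using fin \<sigma> by (rule transported_permutes)
  note bij = bij_betw_entry[OF fin]
  define x where "x r = (if r \<in> J then y (inv_into {..<card J} (entry J) r) else anchor z d r)" for r
  have x_entry: "x (entry J i) = y i" if "i < card J" for i
    using that bij_betwE[OF bij] bij_betw_inv_into_left[OF bij] by (simp add: x_def)
  have xJ: "x r \<in> path_image (\<gamma> r) \<inter> chopstick z (\<tau> r)" if r: "r \<in> J" for r
  proof -
    obtain i where i: "i < card J" "r = entry J i"
      using r bij by (auto simp: bij_betw_def)
    then show ?thesis
      using y[OF i(1)] x_entry[OF i(1)] transported_entry[OF fin i(1)] by (simp add: \<tau>_def)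
  qed
  have Y_eq: "Y = x ` J"
  proof -
    have "x ` J = x ` entry J ` {..<card J}"
      using bij by (simp add: bij_betw_def)
    then show ?thesis
      unfolding Y by (simp add: image_image x_entry)
  qed
  have \<tau>_in: "\<tau> r \<in> J" if "r \<in> J" for r
    using \<tau> that by (simp add: permutes_in_image)
  have "is_state \<tau> x"
    unfolding is_state_def
  proof (intro conjI ballI)
    show "\<tau> permutes {2..n}"
      using \<tau> J by (rule permutes_subset)
    fix r assume r: "r \<in> {2..n}"
    show "x r \<in> path_image (\<beta> r)"
      using xJ[of r] gamma_iff_beta[OF r, of "\<tau> r" "x r"] \<tau>_in[of r] J anchor_in_beta[of r]
      by (cases "r \<in> J") (auto simp: x_def)
    show "x r \<in> chopstick z (\<tau> r) \<or> \<tau> r = r \<and> x r = anchor z d r"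
      using xJ[of r] permutes_not_in[OF \<tau>] by (cases "r \<in> J") (auto simp: x_def)
  qed
  moreover have J_eq: "J = {r \<in> {2..n}. x r \<noteq> anchor z d r}"
  proof -
    have "x r \<noteq> anchor z d r" if "r \<in> J" for r
      using xJ[OF that] \<tau>_in[OF that] that J anchor_notin_chopstick by (metis IntD2 subsetD)
    then show ?thesis
      using J by (auto simp: x_def)
  qed
  moreover have "generator_of (J, \<sigma>, Y) = points x"
  proof -
    have "x ` {2..n} = x ` J \<union> x ` ({2..n} - J)"
      using J by blast
    also have "x ` ({2..n} - J) = anchor z d ` ({2..n} - J)"
      by (simp add: x_def)
    finally have "x ` {2..n} = Y \<union> anchor z d ` ({2..n} - J)"
      by (simp only: Y_eq)
    then show ?thesis
      by (simp only: generator_of_def prod.case points_eq_image)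
  qed
  ultimately show thesis
    using that Y_eq xJ unfolding \<tau>_def by blast
qed

text \<open>
  An anchor of \<open>\<beta>\<^sub>r\<close> lies on no \<open>\<alpha>\<close>-curve but \<open>\<alpha>\<^sub>r\<close>. Hence the permutation of a state fixes the
  indices with anchors, and it restricts to the set of the other indices.
\<close>

lemma state_obtains_summand:
  assumes "is_state \<tau> x"
  obtains s where "s \<in> summands n z \<gamma>" "generator_of s = points x"
proof -
  define J where "J = {r \<in> {2..n}. x r \<noteq> anchor z d r}"
  have J: "J \<subseteq> {2..n}" "finite J"
    by (auto simp: J_def)
  have x_beta: "x r \<in> path_image (\<beta> r)" if "r \<in> {2..n}" for r
    using that assms by (simp add: is_state_def)
  have \<tau>': "\<tau> permutes {2..n}"
    using assms by (simp add: is_state_def)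
  have \<tau>: "\<tau> permutes J"
  proof (rule permutes_superset[OF \<tau>'])
    fix r assume r: "r \<in> {2..n} - J"
    then have "\<tau> r \<in> {2..n}"
      using \<tau>' by (simp only: permutes_in_image Diff_iff)
    moreover have "r \<in> {2..n}" "x r = anchor z d r"
      using r by (auto simp: J_def)
    moreover from this have "x r \<in> chopstick z (\<tau> r) \<or> \<tau> r = r"
      using assms unfolding is_state_def by blast
    ultimately show "\<tau> r = r"
      using anchor_notin_chopstick[of r "\<tau> r"] by auto
  qed
  then have "\<tau> \<in> transported J ` {\<sigma>. \<sigma> permutes {..<card J}}"
    using bij_betw_imp_surj_on[OF bij_betw_transported[OF J(2)]] by simp
  then obtain \<sigma> where \<sigma>: "\<sigma> permutes {..<card J}" "transported J \<sigma> = \<tau>"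
    by auto
  have xJ: "x r \<in> path_image (\<gamma> r) \<inter> chopstick z (\<tau> r)" if r: "r \<in> J" for r
  proof -
    have "\<tau> r \<in> J"
      using r \<tau> by (simp add: permutes_in_image)
    moreover have "x r \<in> chopstick z (\<tau> r)"
      using assms r by (auto simp: is_state_def J_def)
    ultimately show ?thesis
      using gamma_iff_beta[of r "\<tau> r" "x r"] x_beta[of r] r J(1) by blast
  qed
  have "x ` J = x ` entry J ` {..<card J}"
    using bij_betw_entry[OF J(2)] by (simp add: bij_betw_def)
  then have "x ` J = (\<lambda>i. x (entry J i)) ` {..<card J}"
    by (simp only: image_image)
  moreover have "x (entry J i) \<in> path_image (\<gamma> (entry J i)) \<inter> chopstick z (entry J (\<sigma> i))"
    if "i < card J" for i
    using xJ[of "entry J i"] transported_entry[OF J(2) that, of \<sigma>] \<sigma>(2) that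
      bij_betwE[OF bij_betw_entry[OF J(2)]] by simp
  ultimately have "x ` J \<in> Gamma_set z \<gamma> J J \<sigma>"
    unfolding Gamma_set_def by blast
  then have "(J, \<sigma>, x ` J) \<in> summands n z \<gamma>"
    using J \<sigma> by (simp add: summands_def)
  moreover have "generator_of (J, \<sigma>, x ` J) = points x"
  proof -
    have "x ` {2..n} = x ` J \<union> x ` ({2..n} - J)"
      using J by blast
    also have "x ` ({2..n} - J) = anchor z d ` ({2..n} - J)"
      by (rule image_cong) (auto simp: J_def)
    finally show ?thesis
      by (simp only: generator_of_def prod.case points_eq_image)
  qed
  ultimately show thesis
    using that by blast
qed

section \<open>The bijection and the weights\<close>

lemma bij_betw_generator_of: "bij_betw generator_of (summands n z \<gamma>) (generators H)"
proof (rule bij_betw_imageI)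
  show "inj_on generator_of (summands n z \<gamma>)"
  proof (rule inj_onI)
    fix s s' assume s: "s \<in> summands n z \<gamma>" "s' \<in> summands n z \<gamma>" "generator_of s = generator_of s'"
    obtain J \<sigma> Y J' \<sigma>' Y' where eqs: "s = (J, \<sigma>, Y)" "s' = (J', \<sigma>', Y')"
      by (metis prod_cases3)
    obtain x where x: "is_state (transported J \<sigma>) x" "J = {r \<in> {2..n}. x r \<noteq> anchor z d r}" "Y = x ` J"
      "generator_of s = points x"
      using s(1) unfolding eqs by (rule summand_obtains_state)
    obtain x' where x': "is_state (transported J' \<sigma>') x'" "J' = {r \<in> {2..n}. x' r \<noteq> anchor z d r}" "Y' = x' ` J'"
      "generator_of s' = points x'"
      using s(2) unfolding eqs by (rule summand_obtains_state)
    have points: "points x = points x'"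
      using x x' s(3) by simp
    have "x r = x' r" if "r \<in> {2..n}" for r
      using generator_of_state(2)[OF x(1) that] generator_of_state(2)[OF x'(1) that] points by simp
    then have "J = J'"
      unfolding x(2) x'(2) by auto
    moreover have "Y = Y'"
      unfolding x(3) x'(3) \<open>J = J'\<close>
      using \<open>\<And>r. r \<in> {2..n} \<Longrightarrow> x r = x' r\<close> x'(2) by (intro image_cong) auto
    moreover have "transported J \<sigma> = transported J' \<sigma>'"
      using generator_of_state(3)[OF x(1)] generator_of_state(3)[OF x'(1)] points by simp
    moreover have "finite J" "\<sigma> permutes {..<card J}" "\<sigma>' permutes {..<card J'}"
      using s finite_subset[of J "{2..n}"] by (auto simp: eqs summands_def)
    ultimately show "s = s'"
      using bij_betw_transported[of J] unfolding eqs bij_betw_def inj_on_def by auto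
  qed
  show "generator_of ` summands n z \<gamma> = generators H"
  proof
    show "generator_of ` summands n z \<gamma> \<subseteq> generators H"
    proof (rule image_subsetI)
      fix s assume s: "s \<in> summands n z \<gamma>"
      obtain J \<sigma> Y where eq: "s = (J, \<sigma>, Y)"
        by (rule prod_cases3)
      obtain x where "is_state (transported J \<sigma>) x" "generator_of s = points x"
        using s unfolding eq by (rule summand_obtains_state)
      then show "generator_of s \<in> generators H"
        using generator_of_state(1) by simp
    qed
    show "generators H \<subseteq> generator_of ` summands n z \<gamma>"
      by (metis generator_obtains_state imageI state_obtains_summand subsetI)
  qed
qed

text \<open>
  The \<open>n - 1 - |J|\<close> anchors have sign \<open>-1\<close> and do not contribute to the Alexander grading. Together
  with the normalization \<open>(-1)\<^bsup>1-n\<^esup>\<close> their signs give the factor \<open>(-1)\<^bsup>|J|\<^esup>\<close> of the state sum. All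
  other factors agree point by point.
\<close>

lemma generator_of_weight:
  assumes s: "s \<in> summands n z \<gamma>" and n: "1 \<le> n"
    and M: "(- 1) powi m = (of_int (maslov_sign n z h \<beta> (generator_of s)) :: rat)"
  shows "monomial 0 ((- 1) powi (1 - int n)) * prefactor n e *
      generator_weight m (alexander n z \<kappa> d \<gamma> \<beta> (generator_of s)) = summand_weight n z \<kappa> \<gamma> e s"
proof -
  obtain J \<sigma> Y where eq: "s = (J, \<sigma>, Y)"
    by (rule prod_cases3)
  define \<tau> where "\<tau> = transported J \<sigma>"
  obtain x where x: "is_state \<tau> x" and J_eq: "J = {r \<in> {2..n}. x r \<noteq> anchor z d r}" and Y: "Y = x ` J"
    and chop: "\<And>r. r \<in> J \<Longrightarrow> x r \<in> chopstick z (\<tau> r)" and gen: "generator_of s = points x"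
    using s unfolding eq \<tau>_def by (rule summand_obtains_state) blast
  have J: "J \<subseteq> {2..n}" "finite J"
    by (auto simp: J_eq)
  have \<sigma>: "\<sigma> permutes {..<card J}"
    using s by (simp add: eq summands_def)
  have \<tau>: "\<tau> permutes J"
    unfolding \<tau>_def using J(2) \<sigma> by (rule transported_permutes)
  have \<tau>_in: "\<tau> r \<in> {2..n}" if "r \<in> J" for r
    using that \<tau> J(1) permutes_in_image[OF \<tau>, of r] by blast
  note point = generator_of_state(2)[OF x]
  have upper: "x r \<in> path_image (\<gamma> j) \<longleftrightarrow> j = r" if "r \<in> J" "j \<in> {2..n}" for r j
  proof -
    have "\<tau> r \<in> {2..n}"
      using that(1) by (rule \<tau>_in)
    then show ?thesis
      using gamma_iff_beta[OF that(2) _ chop[OF that(1)]] state_in_beta_iff[OF x _ that(2)] that(1) J(1)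
      by blast
  qed
  have summand_point: "summand_point \<gamma> Y r = x r" if "r \<in> J" for r
    unfolding summand_point_def Y
    using that upper J(1) by (intro the_equality) blast+
  let ?v = "\<lambda>r. vertical_sign (\<gamma> r) (z (\<tau> r)) (x r)"
  define A where "A = (\<Sum>r\<in>J. sheet n z \<kappa> \<gamma> r (x r))"
  have alexander: "alexander n z \<kappa> d \<gamma> \<beta> (points x) = A"
  proof -
    have "{r. r \<in> {2..n} \<and> generator_point \<beta> (points x) r \<noteq> anchor z d r} = J"
      unfolding J_eq using point by auto
    then show ?thesis
      unfolding alexander_def A_def using J(1) point by (intro sum.cong) auto
  qed
  have "(\<Prod>r\<in>{2..n}. vertical_sign (\<beta> r) (z (\<tau> r)) (generator_point \<beta> (points x) r))
      = (\<Prod>r\<in>{2..n}. vertical_sign (\<beta> r) (z (\<tau> r)) (x r))"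
    using point by (intro prod.cong) auto
  also have "\<dots> = (\<Prod>r\<in>{2..n} - J. vertical_sign (\<beta> r) (z (\<tau> r)) (x r)) *
      (\<Prod>r\<in>J. vertical_sign (\<beta> r) (z (\<tau> r)) (x r))"
    using J by (intro prod.subset_diff) auto
  also have "(\<Prod>r\<in>{2..n} - J. vertical_sign (\<beta> r) (z (\<tau> r)) (x r)) = (\<Prod>r\<in>{2..n} - J. - 1)"
  proof (rule prod.cong)
    fix r assume r: "r \<in> {2..n} - J"
    then have "\<tau> r = r" "x r = anchor z d r"
      using permutes_not_in[OF \<tau>] by (auto simp: J_eq)
    then show "vertical_sign (\<beta> r) (z (\<tau> r)) (x r) = - 1"
      by (simp add: vertical_sign_anchor)
  qed simp
  also have "(\<Prod>r\<in>J. vertical_sign (\<beta> r) (z (\<tau> r)) (x r)) = (\<Prod>r\<in>J. ?v r)"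
  proof (rule prod.cong)
    fix r assume r: "r \<in> J"
    have "\<tau> r \<in> {2..n}"
      using r by (rule \<tau>_in)
    moreover have "x r \<in> path_image (\<beta> r)"
      using x r J(1) by (auto simp: is_state_def)
    ultimately show "vertical_sign (\<beta> r) (z (\<tau> r)) (x r) = ?v r"
      using r J(1) chop[OF r] by (intro vertical_sign_chopstick) auto
  qed simp
  finally have maslov: "maslov_sign n z h \<beta> (points x)
      = sign \<tau> * ((- 1) ^ (n - 1 - card J) * (\<Prod>r\<in>J. ?v r))"
    using J by (simp add: maslov_sign_def Let_def generator_of_state(3)[OF x] card_Diff_subset)
  have "(\<Prod>i<card J. of_int (vertical_sign (\<gamma> (entry J i)) (z (entry J (\<sigma> i))) (summand_point \<gamma> Y (entry J i))) *
          monomial (of_int (sheet n z \<kappa> \<gamma> (entry J i) (summand_point \<gamma> Y (entry J i)))) 1)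
      = (\<Prod>i<card J. of_int (?v (entry J i)) * monomial (of_int (sheet n z \<kappa> \<gamma> (entry J i) (x (entry J i)))) 1)"
    using bij_betwE[OF bij_betw_entry[OF J(2)]]
    by (intro prod.cong) (auto simp: \<tau>_def transported_entry J(2) summand_point)
  also have "\<dots> = (\<Prod>r\<in>J. of_int (?v r) * monomial (of_int (sheet n z \<kappa> \<gamma> r (x r))) 1)"
    by (rule prod.reindex_bij_betw[OF bij_betw_entry[OF J(2)]])
  also have "\<dots> = monomial (of_int A) (of_int (\<Prod>r\<in>J. ?v r))"
    unfolding A_def using J(2) by (rule prod_monomial)
  finally have weight: "summand_weight n z \<kappa> \<gamma> e s = prefactor n e *
      ((- 1) ^ card J * of_int (sign \<sigma>) * monomial (of_int A) (of_int (\<Prod>r\<in>J. ?v r)))"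
    by (simp add: eq summand_weight_def)
  have "card J \<le> n - 1"
    using card_mono[OF _ J(1)] by simp
  then have "(- 1) powi (1 - int n) * (- 1) ^ (n - 1 - card J) = ((- 1) ^ card J :: rat)"
  proof -
    obtain k where k: "n = Suc (card J + k)"
      using \<open>card J \<le> n - 1\<close> n by (metis Suc_diff_1 le_Suc_ex less_eq_Suc_le One_nat_def)
    then have "1 - int n = - int (card J + k)"
      by simp
    then have "(- 1 :: rat) powi (1 - int n) = (- 1) ^ (card J + k)"
      by (simp only: power_int_minus power_int_of_nat flip: power_inverse) simp
    then show ?thesis
      by (simp add: k power_add mult.assoc flip: power_mult_distrib)
  qed
  then have coeff: "(- 1) powi (1 - int n) * (- 1) powi m
      = ((- 1) ^ card J * of_int (sign \<sigma>) * of_int (\<Prod>r\<in>J. ?v r) :: rat)"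
    unfolding M gen maslov using sign_transported[OF J(2) \<sigma>] by (simp add: \<tau>_def)
  have "monomial 0 ((- 1) powi (1 - int n)) * monomial (of_int A) ((- 1) powi m)
      = monomial (of_int A) ((- 1) powi (1 - int n) * (- 1) powi m)"
    by (simp add: mult_single)
  also have "\<dots> = monomial 0 (of_int ((- 1) ^ card J * sign \<sigma>)) * monomial (of_int A) (of_int (\<Prod>r\<in>J. ?v r))"
    unfolding coeff mult_single by simp
  also have "\<dots> = (- 1) ^ card J * of_int (sign \<sigma>) * monomial (of_int A) (of_int (\<Prod>r\<in>J. ?v r))"
    by (simp only: single_of_int) simp
  finally show ?thesis
    unfolding weight gen alexander generator_weight_def by (simp add: ac_simps)
qed

end

theorem theorem1p3:
  fixes n :: nat and z :: "nat \<Rightarrow> real"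
    and b :: "(complex \<Rightarrow> complex) set"
    and \<rho> \<rho>' :: "complex \<Rightarrow> complex"
    and \<delta> \<kappa> d h :: real
    and \<gamma> \<beta> :: "nat \<Rightarrow> real \<Rightarrow> complex"
    and M :: "surface_point set \<Rightarrow> int"
  assumes "1 \<le> n" and "punctures n z"
    and "b \<in> braid_group n z" and "\<rho> \<in> b" and "\<rho>' \<in> b"
    and "\<gamma> = noodle_image z \<delta> \<rho>" and "thin_noodles n z \<delta>"
    and "narrow_cuts n z \<kappa>" and "transverse_noodles n z \<kappa> \<gamma>"
    and "\<beta> = beta_curve z d \<rho>'" and "thin_bridges n z d h \<beta>"
    and "\<forall>j\<in>{2..n}. coincide (\<gamma> j) (\<beta> j)"
    and "\<forall>X\<in>generators (heegaard_diagram n z h \<beta>). (- 1) powi M X = (of_int (maslov_sign n z h \<beta> X) :: rat)"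
  shows "\<exists>f. bij_betw f (generators (heegaard_diagram n z h \<beta>)) (summands n z \<gamma>) \<and>
           (\<forall>X\<in>generators (heegaard_diagram n z h \<beta>).
              monomial 0 ((- 1) powi (1 - int n)) * prefactor n (braid_exponent n z b) *
                generator_weight (M X) (alexander n z \<kappa> d \<gamma> \<beta> X) =
              summand_weight n z \<kappa> \<gamma> (braid_exponent n z b) (f X))"
proof -
  have "braid_homeo n z \<rho>'"
    using assms(3,5) by (auto simp: braid_group_def isotopy_class_def dest: homotopic_with_imp_property)
  then interpret bridge_diagram n z d h \<rho>' \<gamma> \<beta>
    using assms by unfold_locales auto
  let ?f = "inv_into (summands n z \<gamma>) generator_of"
  have bij: "bij_betw ?f (generators H) (summands n z \<gamma>)"
    using bij_betw_generator_of by (rule bij_betw_inv_into)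
  moreover have "monomial 0 ((- 1) powi (1 - int n)) * prefactor n (braid_exponent n z b) *
        generator_weight (M X) (alexander n z \<kappa> d \<gamma> \<beta> X) =
      summand_weight n z \<kappa> \<gamma> (braid_exponent n z b) (?f X)" if X: "X \<in> generators H" for X
  proof -
    have "generator_of (?f X) = X"
      using bij_betw_inv_into_right[OF bij_betw_generator_of X] .
    then show ?thesis
      using generator_of_weight[of "?f X" "M X"] bij_betwE[OF bij] X assms(1,13) by auto
  qed
  ultimately show ?thesis
    by blast
qed

end
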